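(* (i) If $\limsup_{t\to\infty}\mu^*/(r(t)\log R(t))<1/\ell$, then $X^*<\infty$ almost surely. Conversely, $\mathbb{P}(X^*=\infty)>0$ provided $\liminf_{t\to\infty}\mu^*/(r(t)\log R(t))>1/\ell$. (ii) Assume $r(t)=at^b$ with $a>0$ and $b>0$. Then, as $t\to\infty$, \[ \mathbb{P}(X^*>t)\ \approx_{\log}\ \mathbb{P}(D^*>t)\ \approx_{\log}\ \exp\Bigl\{-\frac{ab}{b+1}\,t^{b+1}\log t\,/\,\ell\Bigr\}. \]
   Context: A task requiring a fixed amount of work $\ell>0$ is processed from time $0$ at time-varying rate $r(t)$, where $r$ is continuous on $[0,\infty)$, strictly positive on $(0,\infty)$, and $\int_0^\infty r(t)\,\mathrm{d}t=\infty$. Put $R(t)=\int_0^t r(s)\,\mathrm{d}s$, with inverse $R^{-1}$. Failures occur at the epochs $0<T_1^*<T_2^*<\cdots$ of a homogeneous Poisson process on $(0,\infty)$ with constant rate $\mu^*>0$; put $T_0^*=0$. At each failure all the work done so far is lost and the task is restarted from scratch. Thus, if the task is not completed at $T_{n-1}^*$, it is still uncompleted at $T_n^*$ if and only if $R(T_n^* )-R(T_{n-1}^* )<\ell$. The delay (the sum of the times of the unsuccessful attempts) is $D^*=\min\{T_n^*:\ n\ge 0,\ R(T_{n+1}^* )-R(T_n^* )\ge\ell\}$, with $D^*=\infty$ if there is no such $n$, and the total task time is $X^*=R^{-1}(R(D^* )+\ell)$, with $X^*=\infty$ if $D^*=\infty$. The relation $f(t)\approx_{\log} g(t)$ means $\log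 f(t)/\log g(t)\to 1$ as $t\to\infty$. *)

theory Defs
  imports "HOL-Probability.Probability"
begin

text \<open>Epochs \<open>T 1 < T 2 < \<dots>\<close> of a homogeneous Poisson process on the positive half-line with
  rate \<open>\<mu>\<close>, with the convention \<open>T 0 = 0\<close>: the interarrival times are independent and
  exponentially distributed with parameter \<open>\<mu>\<close>.\<close>

definition poisson_epochs :: "'a measure \<Rightarrow> real \<Rightarrow> (nat \<Rightarrow> 'a \<Rightarrow> real) \<Rightarrow> bool" where
  "poisson_epochs M \<mu> T \<longleftrightarrow>
     (\<forall>\<omega>\<in>space M. T 0 \<omega> = 0 \<and> strict_mono (\<lambda>n. T n \<omega>)) \<and>
     prob_space.indep_vars M (\<lambda>_. borel) (\<lambda>n \<omega>. T (Suc n) \<omega> - T n \<omega>) UNIV \<and>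
     (\<forall>n. distributed M lborel (\<lambda>\<omega>. T (Suc n) \<omega> - T n \<omega>) (exponential_density \<mu>))"

definition cumulative_work :: "(real \<Rightarrow> real) \<Rightarrow> real \<Rightarrow> real" where
  "cumulative_work r t = integral {0..t} r"

definition inverse_work :: "(real \<Rightarrow> real) \<Rightarrow> real \<Rightarrow> real" where
  "inverse_work r = inv_into {0..} (cumulative_work r)"

text \<open>The infimum is a minimum when the set is nonempty, since the epochs increase with their index;
  for the empty set, \<open>Inf {} = \<infinity>\<close> in the extended reals.\<close>

definition delay :: "(real \<Rightarrow> real) \<Rightarrow> real \<Rightarrow> (nat \<Rightarrow> 'a \<Rightarrow> real) \<Rightarrow> 'a \<Rightarrow> ereal" where
  "delay r l T \<omega> =
     Inf {ereal (T n \<omega>) | n. cumulative_work r (T (Suc n) \<omega>) - cumulative_work r (T n \<omega>) \<ge> l}"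

definition task_time :: "(real \<Rightarrow> real) \<Rightarrow> real \<Rightarrow> (nat \<Rightarrow> 'a \<Rightarrow> real) \<Rightarrow> 'a \<Rightarrow> ereal" where
  "task_time r l T \<omega> =
     (if delay r l T \<omega> = \<infinity> then \<infinity>
      else ereal (inverse_work r (cumulative_work r (real_of_ereal (delay r l T \<omega>)) + l)))"

definition log_equiv :: "(real \<Rightarrow> real) \<Rightarrow> (real \<Rightarrow> real) \<Rightarrow> bool" where
  "log_equiv f g \<longleftrightarrow> ((\<lambda>t. ln (f t) / ln (g t)) \<longlongrightarrow> 1) at_top"

end

theory Submission
  imports Defs "HOL-Real_Asymp.Real_Asymp"
begin

text \<open>Measured in accumulated work \<open>u = R t\<close>, the failures form a Poisson process whose intensity at
  \<open>R t\<close> is \<open>\<mu> / r t\<close>, and the task is completed in the first gap between failures of work-length at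
  least \<open>l\<close>. Apart from the unboundedness of the epochs, the failure process enters only through its
  void probabilities: a finite union \<open>B\<close> of intervals contains no epoch with probability
  \<open>exp (- \<mu> * \<bar>B\<bar>)\<close>, where \<open>\<bar>B\<bar>\<close> is the total length (\<open>prob_void_cells\<close>). Since this is multiplicative over disjoint intervals, the cells of any partition are empty independently
  of each other (\<open>prob_cells_hit_and_void\<close>). All partitions below are equally spaced in work, and the
  mean value theorem turns a cell of work \<open>\<delta>\<close> into a time interval of length \<open>\<delta> / r \<xi>\<close> with \<open>\<xi>\<close> in
  the cell.

  Slow failures: an empty cell of work \<open>l\<close> forces a gap of at least \<open>l\<close>. If
  \<open>\<mu> / r t \<le> c * ln (R t)\<close> for large \<open>t\<close> with \<open>c * l < 1\<close>, then for large \<open>k\<close> cell \<open>k\<close>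
  is empty with probability at least \<open>((k + 1) * l) powr - (c * l)\<close>; these sum to infinity, so by independence some cell is empty almost
  surely.

  Fast failures: a gap of at least \<open>l\<close> contains \<open>m\<close> consecutive empty cells of work
  \<open>\<delta> = l / (m + 1)\<close>. If \<open>\<mu> / r t \<ge> c * ln (R t)\<close> for large \<open>t\<close> with \<open>c * l > 1\<close>, this happens
  from cell \<open>j\<close> on with probability at most \<open>(j * \<delta>) powr - (c * m * \<delta>)\<close>, which is summable once \<open>m\<close> is large. So
  with positive probability no such window occurs far out, and independently of that, the finitely
  many early cells are all hit with positive probability.

  Power rates: \<open>D > t\<close> forces all cells of work \<open>l\<close> before \<open>t\<close> to be hit, and it is implied by hitting
  every \<open>m\<close>-th cell of work \<open>l / (m + 1)\<close> up to just after \<open>t\<close>. Either way the probability is a product of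
  roughly \<open>R t / l\<close> factors, up to the ratio \<open>(m + 1) / m\<close>, and a cell of fixed work is hit with
  probability of order \<open>1 / r t\<close>. As \<open>ln (r t) \<sim> b * ln t\<close>, and as \<open>ln\<close> does not feel replacing \<open>t\<close> by
  \<open>\<kappa> * t\<close>, the logarithm of the probability is \<open>- (R t / l) * b * ln t\<close> to leading order
  (\<open>delay_tail_log_asymptotics\<close>). Finally \<open>R X = R D + l\<close>, so the tail of \<open>X\<close> at \<open>t\<close> lies between the
  tails of \<open>D\<close> at \<open>t\<close> and at \<open>t - 1\<close>, between which the exponent changes only to lower order.\<close>

section \<open>Void probabilities of the failure process\<close>

text \<open>Since \<open>max y (c (Suc i)) - max y (c i)\<close> is the length of the part of cell \<open>i\<close> beyond \<open>y\<close>, the value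
  \<open>w y\<close> is the probability that a Poisson process restarted at \<open>y\<close> avoids \<open>B\<close>. The identity says that \<open>w\<close> is
  harmonic for the walk with exponential steps that is killed on entering \<open>B\<close>. It holds because
  \<open>- exp (- \<mu> * x) * w (s + x)\<close> is an antiderivative of the integrand away from the cell
  boundaries: outside \<open>B\<close> only the exponential decays, while inside \<open>B\<close> the growth of \<open>w\<close> cancels the
  decay exactly.\<close>
lemma exponential_step_avoiding_cells:
  fixes c :: "nat \<Rightarrow> real" and J :: "nat set" and \<mu> s :: real
  assumes c: "mono c" and J: "finite J" and \<mu>: "\<mu> > 0"
  defines "B \<equiv> (\<Union>i\<in>J. {c i<..c (Suc i)})"
    and "w \<equiv> (\<lambda>y. exp (- \<mu> * (\<Sum>i\<in>J. max y (c (Suc i)) - max y (c i))))"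
  shows "(\<integral>\<^sup>+x. ennreal (exponential_density \<mu> x) * ennreal (indicator (- B) (s + x) * w (s + x)) \<partial>lborel)
    = ennreal (w s)"
proof -
  \<comment> \<open>A step longer than \<open>K\<close> jumps over all cells; from there on the integrand is the plain
    exponential density.\<close>
  define K where "K = Max (insert 0 ((\<lambda>i. c (Suc i) - s) ` J))"
  have K0: "0 \<le> K" unfolding K_def using J by simp
  have K: "c (Suc i) - s \<le> K" if "i \<in> J" for i
    unfolding K_def using J that by (intro Max_ge) auto
  have cS: "c i \<le> c (Suc i)" for i using c by (simp add: mono_def)
  define f where "f x = \<mu> * exp (- \<mu> * x) * (indicator (- B) (s + x) * w (s + x))" for x
  define F where "F x = - (exp (- \<mu> * x) * w (s + x))" for x
  define E where "E = (\<lambda>i. c i - s) ` J \<union> (\<lambda>i. c (Suc i) - s) ` J"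
  have finE: "finite E" unfolding E_def using J by simp
  have der: "(F has_real_derivative f x) (at x)" if x: "x \<notin> E" for x
  proof -
    have dmax: "((\<lambda>x. max (s + x) d) has_real_derivative (if d < s + x then 1 else 0)) (at x)"
      if "s + x \<noteq> d" for d
    proof (cases "d < s + x")
      case True
      have "eventually (\<lambda>y. y \<in> {d - s<..}) (nhds x)"
        using True by (intro eventually_nhds_in_open) auto
      then have ev: "eventually (\<lambda>y. max (s + y) d = s + y) (nhds x)"
        by eventually_elim auto
      have "((\<lambda>y. s + y) has_real_derivative 1) (at x)" by (auto intro!: derivative_eq_intros)
      then show ?thesis using True DERIV_cong_ev[OF refl ev refl] by simp
    next
      case False
      have "eventually (\<lambda>y. y \<in> {..<d - s}) (nhds x)"
        using False that by (intro eventually_nhds_in_open) auto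
      then have ev: "eventually (\<lambda>y. max (s + y) d = d) (nhds x)"
        by eventually_elim auto
      then show ?thesis using False DERIV_cong_ev[OF refl ev refl] by simp
    qed
    have ne: "s + x \<noteq> c i" "s + x \<noteq> c (Suc i)" if "i \<in> J" for i
    proof -
      have "x \<noteq> c i - s" "x \<noteq> c (Suc i) - s" using x that by (auto simp: E_def)
      then show "s + x \<noteq> c i" "s + x \<noteq> c (Suc i)" by auto
    qed
    define d where "d i = (if c (Suc i) < s + x then 1 else 0) - (if c i < s + x then 1 else 0 :: real)" for i
    have dsum: "((\<lambda>x. \<Sum>i\<in>J. max (s + x) (c (Suc i)) - max (s + x) (c i)) has_real_derivative (\<Sum>i\<in>J. d i)) (at x)"
      unfolding d_def using ne by (intro DERIV_sum DERIV_diff dmax) auto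
    have dval: "(\<Sum>i\<in>J. d i) = - indicator B (s + x)"
    proof (cases "s + x \<in> B")
      case True
      then obtain k where k: "k \<in> J" "c k < s + x" "s + x \<le> c (Suc k)" by (auto simp: B_def)
      have "d i = 0" if "i \<noteq> k" for i
      proof (cases "i < k")
        case True
        then have "c (Suc i) \<le> c k" using c by (simp add: mono_def Suc_leI)
        then show ?thesis using k cS[of i] by (auto simp: d_def)
      next
        case False
        then have "c (Suc k) \<le> c i" using c that by (simp add: mono_def Suc_leI)
        then show ?thesis using k cS[of i] by (auto simp: d_def)
      qed
      then have "(\<Sum>i\<in>J. d i) = (\<Sum>i\<in>J. if i = k then d k else 0)" by (intro sum.cong) auto
      also have "\<dots> = d k" using J k by simp
      also have "\<dots> = -1" using k by (auto simp: d_def)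
      finally show ?thesis using True by simp
    next
      case False
      then have "d i = 0" if "i \<in> J" for i
        using that cS[of i] by (auto simp: B_def d_def not_less)
      then show ?thesis using False by simp
    qed
    have "(F has_real_derivative
       (- (exp (- \<mu> * x) * (w (s + x) * (- \<mu> * (\<Sum>i\<in>J. d i))) + exp (- \<mu> * x) * (- \<mu>) * w (s + x)))) (at x)"
    proof -
      have "((\<lambda>x. w (s + x)) has_real_derivative w (s + x) * (- \<mu> * (\<Sum>i\<in>J. d i))) (at x)"
        unfolding w_def by (rule DERIV_fun_exp[OF DERIV_cmult[OF dsum]])
      then show ?thesis
        unfolding F_def by (auto intro!: derivative_eq_intros simp: algebra_simps)
    qed
    moreover have "(- (exp (- \<mu> * x) * (w (s + x) * (- \<mu> * (\<Sum>i\<in>J. d i))) + exp (- \<mu> * x) * (- \<mu>) * w (s + x))) = f x"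
      unfolding f_def dval by (auto simp: indicator_def)
    ultimately show ?thesis by simp
  qed
  have fint: "(f has_integral (F K - F 0)) {0..K}"
  proof (rule fundamental_theorem_of_calculus_strong[OF finE K0])
    show "(F has_vector_derivative f x) (at x)" if "x \<in> {0..K} - E" for x
      using der[of x] that by (simp add: has_real_derivative_iff_has_vector_derivative)
    show "continuous_on {0..K} F"
      unfolding F_def w_def by (intro continuous_intros)
  qed
  have wK: "w (s + x) = 1" if "K \<le> x" for x
  proof -
    have "max (s + x) (c (Suc i)) - max (s + x) (c i) = 0" if "i \<in> J" for i
      using K[OF that] cS[of i] \<open>K \<le> x\<close> by auto
    then show ?thesis by (simp add: w_def)
  qed
  have BK: "s + x \<notin> B" if "K < x" for x
    using K that by (force simp: B_def)
  have wpos: "0 \<le> w y" for y by (simp add: w_def)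
  have f0: "0 \<le> f x" for x using \<mu> wpos by (simp add: f_def)
  have I1: "(\<integral>\<^sup>+x. ennreal (f x) * indicator {0..K} x \<partial>lborel) = ennreal (w s - exp (- \<mu> * K))"
    using nn_integral_has_integral_lebesgue'[of "{0..K}" f "F K - F 0", OF f0 fint] wK[of K] by (simp add: F_def)
  have I2: "(\<integral>\<^sup>+x. ennreal (\<mu> * exp (- \<mu> * x)) * indicator {K..} x \<partial>lborel) = ennreal (0 - (- exp (- \<mu> * K)))"
  proof (rule nn_integral_FTC_atLeast)
    show "((\<lambda>x. - exp (- \<mu> * x)) has_real_derivative \<mu> * exp (- \<mu> * x)) (at x)" for x
      by (auto intro!: derivative_eq_intros)
    show "((\<lambda>x. - exp (- \<mu> * x)) \<longlongrightarrow> 0) at_top" using \<mu> by real_asymp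
  qed (use \<mu> in auto)
  have Bm[measurable]: "B \<in> sets borel" unfolding B_def using J by measurable
  have [measurable]: "w \<in> borel_measurable borel" unfolding w_def by measurable
  have [measurable]: "f \<in> borel_measurable borel" unfolding f_def by measurable
  have wle: "exp (- \<mu> * K) \<le> w s"
  proof -
    have "F 0 \<le> F K"
      using has_integral_nonneg[OF fint f0] by simp
    then show ?thesis using wK[of K] by (simp add: F_def)
  qed
  have "(\<integral>\<^sup>+x. ennreal (exponential_density \<mu> x) * ennreal (indicator (- B) (s + x) * w (s + x)) \<partial>lborel)
     = (\<integral>\<^sup>+x. ennreal (f x) * indicator {0..K} x + ennreal (\<mu> * exp (- \<mu> * x)) * indicator {K..} x \<partial>lborel)"
  proof (rule nn_integral_cong_AE)
    show "AE x in lborel. ennreal (exponential_density \<mu> x) * ennreal (indicator (- B) (s + x) * w (s + x))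
       = ennreal (f x) * indicator {0..K} x + ennreal (\<mu> * exp (- \<mu> * x)) * indicator {K..} x"
      using AE_lborel_singleton[of K]
    proof eventually_elim
      case (elim x)
      consider "x < 0" | "0 \<le> x" "x < K" | "K < x" using elim by linarith
      then show ?case
      proof cases
        case 1 then show ?thesis using K0 by (simp add: exponential_density_def)
      next
        case 2 then show ?thesis using \<mu> wpos by (simp add: exponential_density_def f_def ennreal_mult'[symmetric] mult.commute)
      next
        case 3 then show ?thesis using \<mu> K0 wK[of x] BK[of x] by (simp add: exponential_density_def mult.commute)
      qed
    qed
  qed
  also have "\<dots> = ennreal (w s - exp (- \<mu> * K)) + ennreal (exp (- \<mu> * K))"
    using I1 I2 by (subst nn_integral_add) auto
  also have "\<dots> = ennreal (w s)"
    using wle by (subst ennreal_plus[symmetric]) auto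
  finally show ?thesis .
qed

locale poisson_failures = prob_space M for M :: "'a measure" +
  fixes T :: "nat \<Rightarrow> 'a \<Rightarrow> real" and \<mu> :: real
  assumes rate_pos: "\<mu> > 0" and epochs: "poisson_epochs M \<mu> T"
begin

abbreviation gap :: "nat \<Rightarrow> 'a \<Rightarrow> real" where
  "gap n \<omega> \<equiv> T (Suc n) \<omega> - T n \<omega>"

lemma epoch_zero: "\<omega> \<in> space M \<Longrightarrow> T 0 \<omega> = 0"
  and epochs_strict_mono: "\<omega> \<in> space M \<Longrightarrow> strict_mono (\<lambda>n. T n \<omega>)"
  and gaps_indep: "indep_vars (\<lambda>_. borel) gap UNIV"
  and gap_exponential: "distributed M lborel (gap n) (exponential_density \<mu>)"
  using epochs unfolding poisson_epochs_def by auto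

lemma epoch_nonneg: "\<omega> \<in> space M \<Longrightarrow> 0 \<le> T n \<omega>"
  using epochs_strict_mono[of \<omega>, THEN strict_mono_mono, THEN monoD, of 0 n] epoch_zero[of \<omega>] by simp

lemma gap_measurable [measurable]: "gap n \<in> borel_measurable M"
  using gaps_indep by (auto simp: indep_vars_def)

lemma epoch_eq_sum_gaps: "\<omega> \<in> space M \<Longrightarrow> T n \<omega> = (\<Sum>j<n. gap j \<omega>)"
  by (simp add: sum_lessThan_telescope[of "\<lambda>i. T i \<omega>"] epoch_zero)

lemma epoch_measurable [measurable]: "T n \<in> borel_measurable M"
  by (subst measurable_cong[OF epoch_eq_sum_gaps]) measurable

text \<open>One step of conditioning on the past: the next gap is independent of the earlier ones, so it can
  be integrated out against the exponential density while they are held fixed.\<close>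
lemma nn_integral_fresh_gap:
  assumes [measurable]: "\<Phi> \<in> borel_measurable (PiM {..<n} (\<lambda>_. borel) \<Otimes>\<^sub>M borel)"
  shows "(\<integral>\<^sup>+\<omega>. \<Phi> (\<lambda>i\<in>{..<n}. gap i \<omega>, gap n \<omega>) \<partial>M) =
    (\<integral>\<^sup>+\<omega>. (\<integral>\<^sup>+x. ennreal (exponential_density \<mu> x) * \<Phi> (\<lambda>i\<in>{..<n}. gap i \<omega>, x) \<partial>lborel) \<partial>M)"
proof -
  let ?P = "PiM {..<n} (\<lambda>_. borel :: real measure)"
  let ?Y = "\<lambda>\<omega>. \<lambda>i\<in>{..<n}. gap i \<omega>"
  let ?Q = "PiM {n} (\<lambda>_. borel :: real measure)"
  let ?Z = "\<lambda>\<omega>. \<lambda>i\<in>{n}. gap i \<omega>"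
  have ind: "indep_var ?P ?Y ?Q ?Z"
    by (rule indep_var_restrict[OF gaps_indep]) auto
  then have [measurable]: "?Y \<in> measurable M ?P" "?Z \<in> measurable M ?Q"
    by (blast dest: indep_var_rv1 indep_var_rv2)+
  have eq: "distr M ?P ?Y \<Otimes>\<^sub>M distr M ?Q ?Z = distr M (?P \<Otimes>\<^sub>M ?Q) (\<lambda>\<omega>. (?Y \<omega>, ?Z \<omega>))"
    using ind by (simp add: indep_var_distribution_eq)
  interpret G: prob_space "distr M ?Q ?Z" by (rule prob_space_distr) measurable
  have proj[measurable]: "(\<lambda>f. f n) \<in> borel_measurable ?Q"
    by (rule measurable_component_singleton) simp
  have "(\<integral>\<^sup>+\<omega>. \<Phi> (?Y \<omega>, gap n \<omega>) \<partial>M)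
      = (\<integral>\<^sup>+z. \<Phi> (fst z, snd z n) \<partial>distr M (?P \<Otimes>\<^sub>M ?Q) (\<lambda>\<omega>. (?Y \<omega>, ?Z \<omega>)))"
    by (subst nn_integral_distr) auto
  also have "\<dots> = (\<integral>\<^sup>+y. (\<integral>\<^sup>+z. \<Phi> (y, z n) \<partial>distr M ?Q ?Z) \<partial>distr M ?P ?Y)"
    unfolding eq[symmetric] by (subst G.nn_integral_fst[symmetric]) auto
  also have "\<dots> = (\<integral>\<^sup>+\<omega>. (\<integral>\<^sup>+z. \<Phi> (?Y \<omega>, z n) \<partial>distr M ?Q ?Z) \<partial>M)"
    by (subst nn_integral_distr) auto
  also have "\<dots> = (\<integral>\<^sup>+\<omega>. (\<integral>\<^sup>+x. ennreal (exponential_density \<mu> x) * \<Phi> (?Y \<omega>, x) \<partial>lborel) \<partial>M)"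
  proof (rule nn_integral_cong)
    fix \<omega> assume "\<omega> \<in> space M"
    then have [measurable]: "?Y \<omega> \<in> space ?P" by (auto simp: space_PiM)
    have [measurable]: "(\<lambda>x. \<Phi> (?Y \<omega>, x)) \<in> borel_measurable borel" by measurable
    have "(\<integral>\<^sup>+z. \<Phi> (?Y \<omega>, z n) \<partial>distr M ?Q ?Z) = (\<integral>\<^sup>+\<omega>'. \<Phi> (?Y \<omega>, gap n \<omega>') \<partial>M)"
      by (subst nn_integral_distr) auto
    also have "\<dots> = (\<integral>\<^sup>+x. ennreal (exponential_density \<mu> x) * \<Phi> (?Y \<omega>, x) \<partial>lborel)"
      by (subst distributed_nn_integral[OF gap_exponential]) auto
    finally show "(\<integral>\<^sup>+z. \<Phi> (?Y \<omega>, z n) \<partial>distr M ?Q ?Z) =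
      (\<integral>\<^sup>+x. ennreal (exponential_density \<mu> x) * \<Phi> (?Y \<omega>, x) \<partial>lborel)" .
  qed
  finally show ?thesis .
qed

text \<open>The \<open>n\<close>-th epoch has an Erlang law, and \<open>P (T (n + 1) \<le> k)\<close> is the remainder of the exponential
  series after \<open>n + 1\<close> terms, up to a factor, so it vanishes in the limit.\<close>
lemma AE_epochs_unbounded: "AE \<omega> in M. \<forall>K. \<exists>n. K < T n \<omega>"
proof -
  have bound: "AE \<omega> in M. \<exists>n. real k < T n \<omega>" for k :: nat
  proof -
    define S where "S = {\<omega> \<in> space M. \<forall>n. T n \<omega> \<le> real k}"
    have S[measurable]: "S \<in> sets M" unfolding S_def by measurable
    have le: "prob S \<le> erlang_CDF n \<mu> (real k)" for n
    proof -
      define E where "E = (\<lambda>\<omega>. \<Sum>i<Suc n. gap i \<omega>)"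
      have ET: "E \<omega> = T (Suc n) \<omega>" if "\<omega> \<in> space M" for \<omega>
        unfolding E_def by (rule epoch_eq_sum_gaps[OF that, symmetric])
      have "distributed M lborel E (erlang_density (card {..<Suc n} - 1) \<mu>)"
        unfolding E_def using gap_exponential rate_pos
        by (intro exponential_distributed_sum indep_vars_subset[OF gaps_indep]) auto
      then have D: "distributed M lborel E (erlang_density n \<mu>)" by simp
      then have [measurable]: "E \<in> borel_measurable M" by (simp add: distributed_def)
      have "prob S \<le> prob {\<omega> \<in> space M. E \<omega> \<le> real k}"
        by (rule finite_measure_mono) (auto simp: S_def ET)
      also have "\<dots> = erlang_CDF n \<mu> (real k)"
        using erlang_distributed_le[OF D rate_pos, of "real k"] by simp
      finally show ?thesis .
    qed
    have "(\<lambda>n. \<Sum>m\<le>n. (\<mu> * real k) ^ m / fact m) \<longlonglongrightarrow> exp (\<mu> * real k)"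
      using exp_converges[of "\<mu> * real k"] by (simp add: sums_def_le divide_inverse mult.commute)
    then have "(\<lambda>n. 1 - exp (- (\<mu> * real k)) * (\<Sum>m\<le>n. (\<mu> * real k) ^ m / fact m)) \<longlonglongrightarrow>
        1 - exp (- (\<mu> * real k)) * exp (\<mu> * real k)"
      by (intro tendsto_intros)
    then have "(\<lambda>n. erlang_CDF n \<mu> (real k)) \<longlonglongrightarrow> 0"
      by (simp add: erlang_CDF_def sum_distrib_left exp_minus field_simps)
    then have "prob S \<le> 0"
      using le by (intro tendsto_lowerbound[where F=sequentially]) auto
    then have "prob S = 0" using measure_nonneg[of M S] by linarith
    then have "AE \<omega> in M. \<omega> \<notin> S" using S prob_eq_0 by blast
    then show ?thesis using AE_space by eventually_elim (auto simp: S_def not_le)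
  qed
  have "AE \<omega> in M. \<forall>k::nat. \<exists>n. real k < T n \<omega>" using bound by (simp add: AE_all_countable)
  then show ?thesis
  proof eventually_elim
    case (elim \<omega>)
    show ?case
    proof
      fix K
      obtain k :: nat where "K < real k" using reals_Archimedean2 by blast
      then show "\<exists>n. K < T n \<omega>" using elim by (meson less_trans)
    qed
  qed
qed

definition void :: "real set \<Rightarrow> 'a set" where
  "void B = {\<omega> \<in> space M. \<forall>n. T n \<omega> \<notin> B}"

lemma void_measurable [measurable]:
  assumes [measurable]: "B \<in> sets borel"
  shows "void B \<in> sets M"
  unfolding void_def by measurable

text \<open>With the harmonic function \<open>w\<close> of \<open>exponential_step_avoiding_cells\<close>, the expectation of \<open>w (T n)\<close> on
  the event that the first \<open>n\<close> epochs avoid \<open>B\<close> is constant in \<open>n\<close>. It starts at \<open>w 0\<close>, the claimed value;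
  it converges to the void probability, because eventually \<open>T n\<close> has passed all cells, where \<open>w = 1\<close>.\<close>
lemma prob_void_cells:
  fixes c :: "nat \<Rightarrow> real"
  assumes c: "mono c" and c0: "0 \<le> c 0" and J: "finite J"
  shows "prob (void (\<Union>i\<in>J. {c i<..c (Suc i)})) = (\<Prod>i\<in>J. exp (- \<mu> * (c (Suc i) - c i)))"
proof -
  define B where "B = (\<Union>i\<in>J. {c i<..c (Suc i)})"
  define w where "w = (\<lambda>y. exp (- \<mu> * (\<Sum>i\<in>J. max y (c (Suc i)) - max y (c i))))"
  have Bm[measurable]: "B \<in> sets borel" unfolding B_def using J by measurable
  have [measurable]: "w \<in> borel_measurable borel" unfolding w_def by measurable
  have cpos: "0 \<le> c i" for i using c c0 monoD[OF c, of 0 i] by simp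
  have cS: "c i \<le> c (Suc i)" for i using c by (simp add: mono_def)
  have wpos: "0 \<le> w y" for y by (simp add: w_def)
  have w1: "w y \<le> 1" for y
  proof -
    have "0 \<le> max y (c (Suc i)) - max y (c i)" for i using cS[of i] by simp
    then have "0 \<le> (\<Sum>i\<in>J. max y (c (Suc i)) - max y (c i))" by (intro sum_nonneg)
    then show ?thesis using rate_pos by (simp add: w_def)
  qed
  define avoid where "avoid n \<omega> = (if \<forall>i\<le>n. T i \<omega> \<notin> B then 1 else 0 :: real)" for n \<omega>
  have [measurable]: "avoid n \<in> borel_measurable M" for n unfolding avoid_def by measurable
  have step: "(\<integral>\<^sup>+\<omega>. ennreal (avoid (Suc n) \<omega> * w (T (Suc n) \<omega>)) \<partial>M) = (\<integral>\<^sup>+\<omega>. ennreal (avoid n \<omega> * w (T n \<omega>)) \<partial>M)" for n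
  proof -
    let ?P = "PiM {..<n} (\<lambda>_. borel :: real measure)"
    \<comment> \<open>\<open>a\<close> is \<open>avoid n\<close> as a function of the first \<open>n\<close> gaps, the form that conditioning needs.\<close>
    define a where "a f = (if \<forall>i\<in>{..n}. (\<Sum>j<i. f j) \<notin> B then 1 else 0 :: real)" for f :: "nat \<Rightarrow> real"
    define \<Phi> where "\<Phi> = (\<lambda>(f, x). ennreal (a f * (indicator (- B) ((\<Sum>j<n. f j) + x) * w ((\<Sum>j<n. f j) + x))))"
    have sm: "(\<lambda>f. \<Sum>j<i. f j) \<in> borel_measurable ?P" if "i \<le> n" for i
      using that by (intro borel_measurable_sum measurable_component_singleton) auto
    have smn[measurable]: "(\<lambda>f. \<Sum>j<n. f j) \<in> borel_measurable ?P" by (rule sm) simp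
    have [measurable]: "a \<in> borel_measurable ?P"
    proof -
      have "Measurable.pred ?P (\<lambda>f. (\<Sum>j<i. f j) \<notin> B)" if "i \<le> n" for i
        using sm[OF that] by measurable
      then show ?thesis unfolding a_def by (intro measurable_If measurable_const pred_intros_finite) auto
    qed
    have \<Phi>[measurable]: "\<Phi> \<in> borel_measurable (?P \<Otimes>\<^sub>M borel)"
      unfolding \<Phi>_def by measurable
    have Tsum: "(\<Sum>j<i. (\<lambda>j\<in>{..<n}. gap j \<omega>) j) = T i \<omega>" if "\<omega> \<in> space M" "i \<le> n" for i \<omega>
    proof -
      have "(\<Sum>j<i. (\<lambda>j\<in>{..<n}. gap j \<omega>) j) = (\<Sum>j<i. gap j \<omega>)"
        using that by (intro sum.cong) auto
      then show ?thesis using epoch_eq_sum_gaps[OF that(1), of i] by simp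
    qed
    have aT: "a (\<lambda>j\<in>{..<n}. gap j \<omega>) = avoid n \<omega>" if "\<omega> \<in> space M" for \<omega>
      unfolding a_def avoid_def using Tsum[OF that] by auto
    have "(\<integral>\<^sup>+\<omega>. ennreal (avoid (Suc n) \<omega> * w (T (Suc n) \<omega>)) \<partial>M)
        = (\<integral>\<^sup>+\<omega>. \<Phi> (\<lambda>i\<in>{..<n}. gap i \<omega>, gap n \<omega>) \<partial>M)"
    proof (rule nn_integral_cong)
      fix \<omega> assume "\<omega> \<in> space M"
      then show "ennreal (avoid (Suc n) \<omega> * w (T (Suc n) \<omega>)) = \<Phi> (\<lambda>i\<in>{..<n}. gap i \<omega>, gap n \<omega>)"
        using Tsum[of \<omega> n] aT[of \<omega>] by (auto simp: \<Phi>_def avoid_def le_Suc_eq)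
    qed
    also have "\<dots> = (\<integral>\<^sup>+\<omega>. (\<integral>\<^sup>+x. ennreal (exponential_density \<mu> x) * \<Phi> (\<lambda>i\<in>{..<n}. gap i \<omega>, x) \<partial>lborel) \<partial>M)"
      by (rule nn_integral_fresh_gap[OF \<Phi>])
    also have "\<dots> = (\<integral>\<^sup>+\<omega>. ennreal (avoid n \<omega> * w (T n \<omega>)) \<partial>M)"
    proof (rule nn_integral_cong)
      fix \<omega> assume \<omega>: "\<omega> \<in> space M"
      have "(\<integral>\<^sup>+x. ennreal (exponential_density \<mu> x) * \<Phi> (\<lambda>i\<in>{..<n}. gap i \<omega>, x) \<partial>lborel)
         = (\<integral>\<^sup>+x. ennreal (avoid n \<omega>) * (ennreal (exponential_density \<mu> x) * ennreal (indicator (- B) (T n \<omega> + x) * w (T n \<omega> + x))) \<partial>lborel)"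
        using Tsum[OF \<omega>, of n] aT[OF \<omega>] wpos
        by (intro nn_integral_cong) (auto simp: \<Phi>_def avoid_def)
      also have "\<dots> = ennreal (avoid n \<omega>) * (\<integral>\<^sup>+x. ennreal (exponential_density \<mu> x) * ennreal (indicator (- B) (T n \<omega> + x) * w (T n \<omega> + x)) \<partial>lborel)"
        by (intro nn_integral_cmult) measurable
      also have "\<dots> = ennreal (avoid n \<omega>) * ennreal (w (T n \<omega>))"
        unfolding B_def w_def by (subst exponential_step_avoiding_cells[OF c J rate_pos]) simp
      also have "\<dots> = ennreal (avoid n \<omega> * w (T n \<omega>))"
        by (simp add: avoid_def)
      finally show "(\<integral>\<^sup>+x. ennreal (exponential_density \<mu> x) * \<Phi> (\<lambda>i\<in>{..<n}. gap i \<omega>, x) \<partial>lborel) = ennreal (avoid n \<omega> * w (T n \<omega>))" .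
    qed
    finally show ?thesis .
  qed
  have const: "(\<integral>\<^sup>+\<omega>. ennreal (avoid n \<omega> * w (T n \<omega>)) \<partial>M) = ennreal (w 0)" for n
  proof (induction n)
    case 0
    have "0 \<notin> B" using cpos by (auto simp: B_def not_less)
    then have "(\<integral>\<^sup>+\<omega>. ennreal (avoid 0 \<omega> * w (T 0 \<omega>)) \<partial>M) = (\<integral>\<^sup>+\<omega>. ennreal (w 0) \<partial>M)"
      by (intro nn_integral_cong) (auto simp: avoid_def epoch_zero)
    then show ?case by (simp add: emeasure_space_1)
  qed (simp add: step)
  have lim: "(\<lambda>n. \<integral>\<^sup>+\<omega>. ennreal (avoid n \<omega> * w (T n \<omega>)) \<partial>M) \<longlonglongrightarrow> (\<integral>\<^sup>+\<omega>. indicator (void B) \<omega> \<partial>M)"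
  proof (rule nn_integral_dominated_convergence[where w="\<lambda>_. 1"])
    show "AE \<omega> in M. ennreal (avoid n \<omega> * w (T n \<omega>)) \<le> 1" for n
      using w1 wpos by (auto simp: avoid_def)
    show "AE \<omega> in M. (\<lambda>n. ennreal (avoid n \<omega> * w (T n \<omega>))) \<longlonglongrightarrow> indicator (void B) \<omega>"
      using AE_epochs_unbounded AE_space
    proof eventually_elim
      case (elim \<omega>)
      define K where "K = Max (insert 0 ((\<lambda>i. c (Suc i)) ` J))"
      have K: "c (Suc i) \<le> K" if "i \<in> J" for i unfolding K_def using that J by (intro Max_ge) auto
      obtain n0 where n0: "K < T n0 \<omega>" using elim by blast
      have mono: "mono (\<lambda>n. T n \<omega>)" using epochs_strict_mono[OF elim(2)] by (rule strict_mono_mono)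
      have "ennreal (avoid n \<omega> * w (T n \<omega>)) = indicator (void B) \<omega>" if "n0 \<le> n" for n
      proof -
        have big: "K < T i \<omega>" if "n0 \<le> i" for i using n0 monoD[OF mono, OF that] by simp
        have "max (T n \<omega>) (c (Suc i)) - max (T n \<omega>) (c i) = 0" if "i \<in> J" for i
          using K[OF that] cS[of i] big[OF \<open>n0 \<le> n\<close>] by auto
        then have "w (T n \<omega>) = 1" by (simp add: w_def)
        moreover have "T i \<omega> \<notin> B" if "n0 \<le> i" for i
          using big[OF that] K by (force simp: B_def)
        then have "(\<forall>i\<le>n. T i \<omega> \<notin> B) \<longleftrightarrow> (\<forall>i. T i \<omega> \<notin> B)"
          using \<open>n0 \<le> n\<close> by (meson le_cases le_trans)
        ultimately show ?thesis using elim(2) by (simp add: avoid_def void_def)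
      qed
      then show ?case
        by (intro tendsto_eventually) (auto simp: eventually_sequentially)
    qed
  qed (auto simp: emeasure_space_1)
  have "(\<integral>\<^sup>+\<omega>. indicator (void B) \<omega> \<partial>M) = ennreal (w 0)"
    using LIMSEQ_unique[OF lim] const by simp
  then have "emeasure M (void B) = ennreal (w 0)" by simp
  then have "prob (void B) = w 0" using wpos by (simp add: measure_def)
  also have "w 0 = exp (\<Sum>i\<in>J. - \<mu> * (c (Suc i) - c i))"
    using cpos by (simp add: w_def max_absorb2 sum_distrib_left)
  also have "\<dots> = (\<Prod>i\<in>J. exp (- \<mu> * (c (Suc i) - c i)))" using J by (rule exp_sum)
  finally show ?thesis unfolding B_def .
qed

text \<open>Independence of events is a product formula for finite intersections, and the intersection of
  void events is the void event of the union.\<close>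
lemma indep_void_cells:
  assumes c: "mono c" and c0: "0 \<le> c 0"
  shows "indep_events (\<lambda>i. void {c i<..c (Suc i)}) UNIV"
proof (rule indep_eventsI)
  fix J :: "nat set" assume J: "finite J" "J \<noteq> {}"
  have "(\<Inter>i\<in>J. void {c i<..c (Suc i)}) = void (\<Union>i\<in>J. {c i<..c (Suc i)})"
    using J(2) by (auto simp: void_def)
  moreover have "prob (void {c i<..c (Suc i)}) = exp (- \<mu> * (c (Suc i) - c i))" for i
    using prob_void_cells[OF c c0, of "{i}"] by simp
  ultimately show "prob (\<Inter>i\<in>J. void {c i<..c (Suc i)}) = (\<Prod>i\<in>J. prob (void {c i<..c (Suc i)}))"
    using prob_void_cells[OF c c0 J(1)] by simp
qed measurable

text \<open>Independence passes from the void events to the sigma-algebras they generate, so complements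
  may be mixed in.\<close>
lemma prob_cells_hit_and_void:
  assumes c: "mono c" and c0: "0 \<le> c 0" and fin: "finite H" "finite V" and disj: "H \<inter> V = {}"
  shows "prob {\<omega> \<in> space M. (\<forall>i\<in>H. \<omega> \<notin> void {c i<..c (Suc i)}) \<and> (\<forall>i\<in>V. \<omega> \<in> void {c i<..c (Suc i)})} =
    (\<Prod>i\<in>H. 1 - exp (- \<mu> * (c (Suc i) - c i))) * (\<Prod>i\<in>V. exp (- \<mu> * (c (Suc i) - c i)))"
proof (cases "H \<union> V = {}")
  case True
  then show ?thesis by (simp add: prob_space)
next
  case False
  define C where "C i = void {c i<..c (Suc i)}" for i
  define A where "A i = (if i \<in> H then space M - C i else C i)" for i
  have Cm[measurable]: "C i \<in> sets M" for i unfolding C_def by measurable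
  have pC: "prob (C i) = exp (- \<mu> * (c (Suc i) - c i))" for i
    using prob_void_cells[OF c c0, of "{i}"] by (simp add: C_def)
  have "indep_sets (\<lambda>i. {C i}) UNIV"
    using indep_void_cells[OF c c0] unfolding indep_events_def_alt C_def .
  then have "indep_sets (\<lambda>i. sigma_sets (space M) {C i}) UNIV"
    by (rule indep_sets_sigma) (simp add: Int_stable_def)
  moreover have "A i \<in> sigma_sets (space M) {C i}" for i
    unfolding A_def by (auto intro: sigma_sets.intros)
  ultimately have "prob (\<Inter>i\<in>H \<union> V. A i) = (\<Prod>i\<in>H \<union> V. prob (A i))"
    using fin False by (intro indep_setsD) auto
  also have "\<dots> = (\<Prod>i\<in>H. prob (A i)) * (\<Prod>i\<in>V. prob (A i))"
    using fin disj by (rule prod.union_disjoint)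
  also have "(\<Prod>i\<in>H. prob (A i)) = (\<Prod>i\<in>H. 1 - exp (- \<mu> * (c (Suc i) - c i)))"
    by (intro prod.cong) (auto simp: A_def prob_compl pC)
  also have "(\<Prod>i\<in>V. prob (A i)) = (\<Prod>i\<in>V. exp (- \<mu> * (c (Suc i) - c i)))"
    using disj by (intro prod.cong) (auto simp: A_def pC)
  also have "(\<Inter>i\<in>H \<union> V. A i) = {\<omega> \<in> space M. (\<forall>i\<in>H. \<omega> \<notin> C i) \<and> (\<forall>i\<in>V. \<omega> \<in> C i)}"
  proof -
    have "C i \<subseteq> space M" for i by (auto simp: C_def void_def)
    then have "A i \<subseteq> space M" for i by (auto simp: A_def)
    with False have "(\<Inter>i\<in>H \<union> V. A i) = {\<omega> \<in> space M. \<forall>i\<in>H \<union> V. \<omega> \<in> A i}" by blast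
    also have "\<dots> = {\<omega> \<in> space M. (\<forall>i\<in>H. \<omega> \<notin> C i) \<and> (\<forall>i\<in>V. \<omega> \<in> C i)}"
      using disj unfolding A_def by (intro Collect_cong conj_cong refl) auto
    finally show ?thesis .
  qed
  finally show ?thesis unfolding C_def .
qed

end

section \<open>The work clock\<close>

locale work_rate =
  fixes r :: "real \<Rightarrow> real"
  assumes rate_continuous: "continuous_on {0..} r"
    and rate_positive: "\<And>t. t > 0 \<Longrightarrow> r t > 0"
    and work_diverges: "filterlim (cumulative_work r) at_top at_top"
begin

abbreviation R :: "real \<Rightarrow> real" where "R \<equiv> cumulative_work r"
abbreviation R_inv :: "real \<Rightarrow> real" where "R_inv \<equiv> inverse_work r"

lemma work_zero: "t \<le> 0 \<Longrightarrow> R t = 0"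
  by (cases "t = 0") (auto simp: cumulative_work_def)

lemma work_deriv_within:
  assumes "0 \<le> t" "t \<le> K"
  shows "(R has_real_derivative r t) (at t within {0..K})"
  unfolding cumulative_work_def
  using assms by (intro integral_has_real_derivative continuous_on_subset[OF rate_continuous]) auto

lemma work_deriv:
  assumes "0 < t" shows "(R has_real_derivative r t) (at t)"
proof -
  have "at t within {0..t + 1} = at t"
    using assms by (intro at_within_interior) (auto simp: interior_atLeastAtMost_real)
  then show ?thesis using work_deriv_within[of t "t + 1"] assms by simp
qed

lemma work_continuous: "continuous_on {0..K} R"
  using work_deriv_within by (intro DERIV_continuous_on) auto

text \<open>The mean value theorem in the form used throughout: a work increment is converted into a
  duration by dividing by an intermediate rate.\<close>
lemma work_increment:
  assumes "0 \<le> s" "s < t"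
  obtains \<xi> where "s < \<xi>" "\<xi> < t" "R t - R s = (t - s) * r \<xi>"
proof -
  have "\<exists>l \<xi>. s < \<xi> \<and> \<xi> < t \<and> (R has_real_derivative l) (at \<xi>) \<and> R t - R s = (t - s) * l"
  proof (rule MVT)
    show "continuous_on {s..t} R"
      using assms by (intro continuous_on_subset[OF work_continuous[of t]]) auto
    show "R differentiable (at x)" if "s < x" for x
      using work_deriv[of x] that assms unfolding real_differentiable_def by fastforce
  qed (use assms in auto)
  then obtain l \<xi> where *: "s < \<xi>" "\<xi> < t" "(R has_real_derivative l) (at \<xi>)" "R t - R s = (t - s) * l"
    by blast
  then have "l = r \<xi>" using work_deriv[of \<xi>] assms by (auto intro: DERIV_unique)
  then show ?thesis using * that by blast
qed

lemma work_strict_mono: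
  assumes "0 \<le> s" "s < t" shows "R s < R t"
proof -
  obtain \<xi> where "s < \<xi>" "R t - R s = (t - s) * r \<xi>"
    using work_increment[OF assms] by metis
  moreover have "0 < (t - s) * r \<xi>"
    using assms \<open>s < \<xi>\<close> rate_positive[of \<xi>] by simp
  ultimately show ?thesis by simp
qed

lemma work_less_iff: "0 \<le> s \<Longrightarrow> 0 \<le> t \<Longrightarrow> R s < R t \<longleftrightarrow> s < t"
  using work_strict_mono[of s t] work_strict_mono[of t s] by (cases s t rule: linorder_cases) auto

lemma work_le_iff: "0 \<le> s \<Longrightarrow> 0 \<le> t \<Longrightarrow> R s \<le> R t \<longleftrightarrow> s \<le> t"
  using work_less_iff[of t s] by (simp add: not_less[symmetric])

lemma work_mono: "mono R"
proof (rule monoI)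
  fix s t :: real assume "s \<le> t"
  then show "R s \<le> R t"
    using work_le_iff[of s t] work_le_iff[of 0 t] work_zero[of s] work_zero[of t] work_zero[of 0]
    by (cases "s \<le> 0"; cases "t \<le> 0") auto
qed

lemma work_nonneg: "0 \<le> R t"
  using monoD[OF work_mono, of "min 0 t" t] work_zero[of "min 0 t"] by simp

lemma work_measurable [measurable]: "R \<in> borel_measurable borel"
  by (rule borel_measurable_mono[OF work_mono])

lemma work_surj:
  assumes "0 \<le> u" shows "u \<in> R ` {0..}"
proof -
  obtain K where "0 \<le> K" "u \<le> R K"
    using filterlim_at_top[THEN iffD1, OF work_diverges, rule_format, of u]
    by (metis (no_types, lifting) eventually_at_top_linorder linorder_le_cases)
  then have "\<exists>x\<ge>0. x \<le> K \<and> R x = u"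
    using assms work_zero[of 0] by (intro IVT' work_continuous) auto
  then show ?thesis by auto
qed

lemma inverse_work_nonneg: "0 \<le> u \<Longrightarrow> 0 \<le> R_inv u"
  and work_inverse [simp]: "0 \<le> u \<Longrightarrow> R (R_inv u) = u"
  using inv_into_into[OF work_surj] f_inv_into_f[OF work_surj] by (auto simp: inverse_work_def)

lemma inverse_work_less_iff: "0 \<le> u \<Longrightarrow> 0 \<le> t \<Longrightarrow> R_inv u < t \<longleftrightarrow> u < R t"
  using work_less_iff[of "R_inv u" t] by (simp add: inverse_work_nonneg)

lemma less_inverse_work_iff: "0 \<le> u \<Longrightarrow> 0 \<le> t \<Longrightarrow> t < R_inv u \<longleftrightarrow> R t < u"
  using work_less_iff[of t "R_inv u"] by (simp add: inverse_work_nonneg)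

lemma inverse_work_mono: "0 \<le> u \<Longrightarrow> u \<le> v \<Longrightarrow> R_inv u \<le> R_inv v"
  using work_le_iff[of "R_inv u" "R_inv v"] by (simp add: inverse_work_nonneg)

text \<open>Time points equally spaced in work. Partitioning in work rather than in time makes the cells
  commensurable with the task size, whatever the rate.\<close>
definition grid :: "real \<Rightarrow> nat \<Rightarrow> real" where
  "grid \<delta> i = R_inv (real i * \<delta>)"

lemma grid_nonneg: "0 \<le> \<delta> \<Longrightarrow> 0 \<le> grid \<delta> i"
  by (simp add: grid_def inverse_work_nonneg)

lemma work_grid: "0 \<le> \<delta> \<Longrightarrow> R (grid \<delta> i) = real i * \<delta>"
  by (simp add: grid_def)

lemma grid_mono: "0 \<le> \<delta> \<Longrightarrow> mono (grid \<delta>)"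
  unfolding grid_def by (intro monoI inverse_work_mono mult_right_mono) auto

lemma grid_increment:
  assumes "0 < \<delta>" "i < j"
  obtains \<xi> where "grid \<delta> i < \<xi>" "\<xi> < grid \<delta> j" "grid \<delta> j - grid \<delta> i = real (j - i) * \<delta> / r \<xi>"
proof -
  have "R (grid \<delta> i) < R (grid \<delta> j)" using assms by (simp add: work_grid)
  then have lt: "grid \<delta> i < grid \<delta> j" using assms by (simp add: work_less_iff grid_nonneg)
  have "0 \<le> grid \<delta> i" using assms by (simp add: grid_nonneg)
  then obtain \<xi> where \<xi>: "grid \<delta> i < \<xi>" "\<xi> < grid \<delta> j" 
     "R (grid \<delta> j) - R (grid \<delta> i) = (grid \<delta> j - grid \<delta> i) * r \<xi>"
    by (rule work_increment[OF _ lt])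
  have "0 < r \<xi>" using \<xi>(1) \<open>0 \<le> grid \<delta> i\<close> by (intro rate_positive) auto
  then have "grid \<delta> j - grid \<delta> i = real (j - i) * \<delta> / r \<xi>"
    using \<xi>(3) assms by (simp add: work_grid field_simps of_nat_diff)
  then show ?thesis using \<xi> that by blast
qed

end

section \<open>Long gaps and empty cells\<close>

locale restarted_task = work_rate r + poisson_failures M T \<mu>
  for r :: "real \<Rightarrow> real" and M :: "'a measure" and T :: "nat \<Rightarrow> 'a \<Rightarrow> real" and \<mu> :: real +
  fixes l :: real
  assumes work_pos: "0 < l"
begin

abbreviation D :: "'a \<Rightarrow> ereal" where "D \<equiv> delay r l T"
abbreviation X :: "'a \<Rightarrow> ereal" where "X \<equiv> task_time r l T"

abbreviation cell :: "real \<Rightarrow> nat \<Rightarrow> real set" where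
  "cell \<delta> i \<equiv> {grid \<delta> i<..grid \<delta> (Suc i)}"

text \<open>A random index set obstructs measurability of the infimum; giving the value infinity to the short
  gaps turns it into an infimum over all indices.\<close>
lemma delay_measurable [measurable]: "D \<in> borel_measurable M"
proof -
  have "D = (\<lambda>\<omega>. INF n. if l \<le> R (T (Suc n) \<omega>) - R (T n \<omega>) then ereal (T n \<omega>) else \<infinity>)"
  proof
    fix \<omega>
    show "D \<omega> = (INF n. if l \<le> R (T (Suc n) \<omega>) - R (T n \<omega>) then ereal (T n \<omega>) else \<infinity>)"
    proof (rule antisym)
      show "D \<omega> \<le> (INF n. if l \<le> R (T (Suc n) \<omega>) - R (T n \<omega>) then ereal (T n \<omega>) else \<infinity>)"
        unfolding delay_def by (intro INF_greatest) (auto intro!: Inf_lower)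
      show "(INF n. if l \<le> R (T (Suc n) \<omega>) - R (T n \<omega>) then ereal (T n \<omega>) else \<infinity>) \<le> D \<omega>"
        unfolding delay_def
      proof (rule Inf_greatest)
        fix x assume "x \<in> {ereal (T n \<omega>) |n. l \<le> R (T (Suc n) \<omega>) - R (T n \<omega>)}"
        then obtain n where n: "x = ereal (T n \<omega>)" "l \<le> R (T (Suc n) \<omega>) - R (T n \<omega>)" by auto
        then show "(INF n. if l \<le> R (T (Suc n) \<omega>) - R (T n \<omega>) then ereal (T n \<omega>) else \<infinity>) \<le> x"
          by (intro INF_lower2[of n]) auto
      qed
    qed
  qed
  moreover have "(\<lambda>\<omega>. INF n. if l \<le> R (T (Suc n) \<omega>) - R (T n \<omega>) then ereal (T n \<omega>) else \<infinity>)
      \<in> borel_measurable M"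
    by measurable
  ultimately show ?thesis by (simp only:)
qed

lemma delay_nonneg: "\<omega> \<in> space M \<Longrightarrow> 0 \<le> D \<omega>"
  unfolding delay_def by (rule Inf_greatest) (auto simp: epoch_nonneg)

lemma task_time_less_infinity_iff: "X \<omega> < \<infinity> \<longleftrightarrow> D \<omega> < \<infinity>"
  by (simp add: task_time_def)

text \<open>The task time is an increasing function of the delay, which reduces its tail to that of the delay.\<close>
lemma task_time_greater_iff:
  assumes \<omega>: "\<omega> \<in> space M" and t: "0 \<le> t" "l \<le> R t"
  shows "ereal t < X \<omega> \<longleftrightarrow> ereal (R_inv (R t - l)) < D \<omega>"
proof (cases "D \<omega>")
  case (real d)
  then have d: "0 \<le> d" using delay_nonneg[OF \<omega>] by simp
  have "ereal t < X \<omega> \<longleftrightarrow> t < R_inv (R d + l)" using real by (simp add: task_time_def)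
  also have "\<dots> \<longleftrightarrow> R t < R d + l"
    using t work_pos work_nonneg[of d] by (intro less_inverse_work_iff) auto
  also have "\<dots> \<longleftrightarrow> R_inv (R t - l) < d"
    using t d by (subst inverse_work_less_iff) auto
  finally show ?thesis using real by simp
qed (use delay_nonneg[OF \<omega>] in \<open>auto simp: task_time_def\<close>)

text \<open>The last epoch not after \<open>x\<close> starts a gap that covers the empty interval. It exists because some epoch
  lies beyond \<open>x\<close>.\<close>
lemma delay_le_if_void:
  assumes \<omega>: "\<omega> \<in> space M" and unb: "\<exists>n. x < T n \<omega>" and x: "0 \<le> x"
    and quiet: "\<omega> \<in> void {x<..y}" and long: "l \<le> R y - R x"
  shows "D \<omega> \<le> ereal x"
proof -
  define n where "n = (LEAST n. x < T n \<omega>)"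
  have gt: "x < T n \<omega>" unfolding n_def using unb by (rule LeastI_ex)
  have "n \<noteq> 0" using gt x epoch_zero[OF \<omega>] by (metis not_le)
  then obtain m where m: "n = Suc m" by (cases n) auto
  have le: "T m \<omega> \<le> x" using not_less_Least[of m "\<lambda>n. x < T n \<omega>"] m by (simp add: n_def[symmetric])
  have "y < T (Suc m) \<omega>" using gt quiet m by (force simp: void_def)
  then have "l \<le> R (T (Suc m) \<omega>) - R (T m \<omega>)"
    using long monoD[OF work_mono, of y "T (Suc m) \<omega>"] monoD[OF work_mono le] by simp
  then have "D \<omega> \<le> ereal (T m \<omega>)" unfolding delay_def by (intro Inf_lower) auto
  also have "\<dots> \<le> ereal x" using le by simp
  finally show ?thesis .
qed

text \<open>If \<open>D > t\<close>, then every cell of work \<open>l\<close> that starts by time \<open>t\<close> must be hit, since an empty one would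
  end the delay by its left endpoint.\<close>
lemma prob_delay_gt_le:
  assumes H: "finite H" "\<And>k. k \<in> H \<Longrightarrow> real k * l \<le> R t" and t: "0 \<le> t"
  shows "prob {\<omega> \<in> space M. ereal t < D \<omega>} \<le> (\<Prod>k\<in>H. 1 - exp (- \<mu> * (grid l (Suc k) - grid l k)))"
proof -
  have l0: "0 \<le> l" using work_pos by simp
  have "prob {\<omega> \<in> space M. ereal t < D \<omega>} \<le>
      prob {\<omega> \<in> space M. (\<forall>i\<in>H. \<omega> \<notin> void (cell l i)) \<and> (\<forall>i\<in>{}. \<omega> \<in> void (cell l i))}"
  proof (rule finite_measure_mono_AE)
    show "AE \<omega> in M. \<omega> \<in> {\<omega> \<in> space M. ereal t < D \<omega>} \<longrightarrow>
        \<omega> \<in> {\<omega> \<in> space M. (\<forall>i\<in>H. \<omega> \<notin> void (cell l i)) \<and> (\<forall>i\<in>{}. \<omega> \<in> void (cell l i))}"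
      using AE_epochs_unbounded AE_space
    proof eventually_elim
      case (elim \<omega>)
      have "\<omega> \<notin> void (cell l i)" if "i \<in> H" "ereal t < D \<omega>" for i
      proof
        assume v: "\<omega> \<in> void (cell l i)"
        have "D \<omega> \<le> ereal (grid l i)"
          using elim l0 v by (intro delay_le_if_void[OF elim(2) _ _ v]) (auto simp: grid_nonneg work_grid algebra_simps)
        moreover have "grid l i \<le> t"
          using H(2)[OF that(1)] work_le_iff[of "grid l i" t] t l0 by (simp add: grid_nonneg work_grid)
        ultimately show False using that(2) by (metis ereal_less_eq(3) leD order_trans)
      qed
      then show ?case using elim(2) by auto
    qed
    show "{\<omega> \<in> space M. (\<forall>i\<in>H. \<omega> \<notin> void (cell l i)) \<and> (\<forall>i\<in>{}. \<omega> \<in> void (cell l i))} \<in> sets M"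
      using H(1) by measurable
  qed
  also have "\<dots> = (\<Prod>k\<in>H. 1 - exp (- \<mu> * (grid l (Suc k) - grid l k)))"
    using prob_cells_hit_and_void[OF grid_mono[OF l0] grid_nonneg[OF l0] H(1), of "{}"] by simp
  finally show ?thesis .
qed

lemma void_cell_in_long_gap:
  assumes \<omega>: "\<omega> \<in> space M" and \<delta>: "0 < \<delta>"
    and v: "R (T n \<omega>) \<le> real i * \<delta>" and j: "real (Suc j) * \<delta> < R (T (Suc n) \<omega>)" "i \<le> j"
  shows "\<omega> \<in> void (cell \<delta> j)"
proof -
  have 1: "T n \<omega> \<le> grid \<delta> j"
  proof -
    have "R (T n \<omega>) \<le> real j * \<delta>"
      using \<delta> j(2) by (intro order_trans[OF v] mult_right_mono) auto
    then have "R (T n \<omega>) \<le> R (grid \<delta> j)" using \<delta> by (simp add: work_grid)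
    then show ?thesis using \<delta> \<omega> by (simp add: work_le_iff epoch_nonneg grid_nonneg)
  qed
  have 2: "grid \<delta> (Suc j) < T (Suc n) \<omega>"
    using j(1) \<delta> \<omega> work_less_iff[of "grid \<delta> (Suc j)" "T (Suc n) \<omega>"] by (simp add: epoch_nonneg grid_nonneg work_grid)
  have mono: "mono (\<lambda>n. T n \<omega>)" using epochs_strict_mono[OF \<omega>] by (rule strict_mono_mono)
  have "T m \<omega> \<notin> cell \<delta> j" for m
  proof (cases "m \<le> n")
    case True
    then have "T m \<omega> \<le> T n \<omega>" using monoD[OF mono, of m n] by simp
    then show ?thesis using 1 by auto
  next
    case False
    then have "T (Suc n) \<omega> \<le> T m \<omega>" using monoD[OF mono, of "Suc n" m] by simp
    then show ?thesis using 2 by auto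
  qed
  then show ?thesis using \<omega> by (simp add: void_def)
qed

text \<open>A gap of work \<open>l = (m + 1) * \<delta>\<close> need not be aligned with the grid. Rounding its start up to the
  next grid point costs less than one cell, which leaves \<open>m\<close> full cells.\<close>
lemma void_window_in_long_gap:
  assumes \<omega>: "\<omega> \<in> space M" and \<delta>: "\<delta> = l / real (m + 1)"
    and long: "l \<le> R (T (Suc n) \<omega>) - R (T n \<omega>)"
  obtains i where "real i * \<delta> < R (T n \<omega>) + \<delta>" "\<And>j. i \<le> j \<Longrightarrow> j < i + m \<Longrightarrow> \<omega> \<in> void (cell \<delta> j)"
proof -
  have \<delta>0: "0 < \<delta>" using work_pos \<delta> by simp
  define i where "i = nat \<lceil>R (T n \<omega>) / \<delta>\<rceil>"
  have i: "R (T n \<omega>) / \<delta> \<le> real i" "real i < R (T n \<omega>) / \<delta> + 1"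
    using work_nonneg[of "T n \<omega>"] \<delta>0 unfolding i_def by (simp, simp, linarith)
  have lo: "R (T n \<omega>) \<le> real i * \<delta>" using i(1) \<delta>0 by (simp add: field_simps)
  have hi: "real i * \<delta> < R (T n \<omega>) + \<delta>" using i(2) \<delta>0 by (simp add: field_simps)
  have "\<omega> \<in> void (cell \<delta> j)" if j: "i \<le> j" "j < i + m" for j
  proof (rule void_cell_in_long_gap[OF \<omega> \<delta>0 lo _ j(1)])
    have "real (Suc j) * \<delta> \<le> real (i + m) * \<delta>"
      using j \<delta>0 by (intro mult_right_mono) auto
    also have "\<dots> < R (T n \<omega>) + real (m + 1) * \<delta>" using hi by (simp add: algebra_simps)
    also have "real (m + 1) * \<delta> = l" using \<delta> by (simp add: field_simps)
    also have "R (T n \<omega>) + l \<le> R (T (Suc n) \<omega>)" using long by simp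
    finally show "real (Suc j) * \<delta> < R (T (Suc n) \<omega>)" .
  qed
  then show ?thesis using hi that by blast
qed

text \<open>Any \<open>m\<close> consecutive cells include one whose index is a multiple of \<open>m\<close>. If these are hit up to index
  \<open>K * m\<close>, then a long gap can only begin after the grid point \<open>K * m\<close>, which lies beyond \<open>t\<close>.\<close>
lemma prob_delay_gt_ge:
  assumes m: "1 \<le> m" and \<delta>: "\<delta> = l / real (m + 1)" and t: "0 \<le> t" and K: "R t < real (K * m) * \<delta>"
  shows "(\<Prod>k\<le>K. 1 - exp (- \<mu> * (grid \<delta> (Suc (k * m)) - grid \<delta> (k * m))))
    \<le> prob {\<omega> \<in> space M. ereal t < D \<omega>}"
proof -
  have \<delta>0: "0 \<le> \<delta>" using work_pos \<delta> by simp
  let ?H = "(\<lambda>k. k * m) ` {..K}"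
  have inj: "inj_on (\<lambda>k. k * m) {..K}" using m by (auto simp: inj_on_def)
  have "(\<Prod>k\<le>K. 1 - exp (- \<mu> * (grid \<delta> (Suc (k * m)) - grid \<delta> (k * m))))
      = (\<Prod>i\<in>?H. 1 - exp (- \<mu> * (grid \<delta> (Suc i) - grid \<delta> i)))"
    by (subst prod.reindex[OF inj]) simp
  also have "\<dots> = prob {\<omega> \<in> space M. (\<forall>i\<in>?H. \<omega> \<notin> void (cell \<delta> i)) \<and> (\<forall>i\<in>{}. \<omega> \<in> void (cell \<delta> i))}"
    using prob_cells_hit_and_void[OF grid_mono[OF \<delta>0] grid_nonneg[OF \<delta>0], of ?H "{}"] by simp
  also have "\<dots> \<le> prob {\<omega> \<in> space M. ereal t < D \<omega>}"
  proof (rule finite_measure_mono)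
    show "{\<omega> \<in> space M. (\<forall>i\<in>?H. \<omega> \<notin> void (cell \<delta> i)) \<and> (\<forall>i\<in>{}. \<omega> \<in> void (cell \<delta> i))}
      \<subseteq> {\<omega> \<in> space M. ereal t < D \<omega>}"
    proof
      fix \<omega>
      assume "\<omega> \<in> {\<omega> \<in> space M. (\<forall>i\<in>?H. \<omega> \<notin> void (cell \<delta> i)) \<and> (\<forall>i\<in>{}. \<omega> \<in> void (cell \<delta> i))}"
      then have \<omega>: "\<omega> \<in> space M" and hit: "\<And>k. k \<le> K \<Longrightarrow> \<omega> \<notin> void (cell \<delta> (k * m))" by auto
      have late: "grid \<delta> (K * m) \<le> T n \<omega>" if long: "l \<le> R (T (Suc n) \<omega>) - R (T n \<omega>)" for n
      proof -
        obtain i where i: "real i * \<delta> < R (T n \<omega>) + \<delta>" "\<And>j. i \<le> j \<Longrightarrow> j < i + m \<Longrightarrow> \<omega> \<in> void (cell \<delta> j)"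
          using void_window_in_long_gap[OF \<omega> \<delta> long] by metis
        \<comment> \<open>\<open>k * m\<close> is the first multiple of \<open>m\<close> from \<open>i\<close> on.\<close>
        define k where "k = (i + (m - 1)) div m"
        have k: "i \<le> k * m" "k * m < i + m"
        proof -
          have "(i + (m - 1)) mod m < m" using m by simp
          moreover have "k * m + (i + (m - 1)) mod m = i + (m - 1)" by (simp add: k_def)
          ultimately show "i \<le> k * m" "k * m < i + m" using m by linarith+
        qed
        then have "K < k" using i(2)[of "k * m"] hit[of k] by (meson not_less)
        then have "(K + 1) * m \<le> k * m" by (intro mult_right_mono) auto
        then have "K * m + 1 \<le> i" using k by simp
        then have "real (K * m + 1) * \<delta> \<le> real i * \<delta>"
          using \<delta>0 by (intro mult_right_mono of_nat_mono)
        then have "real (K * m) * \<delta> < R (T n \<omega>)" using i(1) by (simp add: algebra_simps)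
        then have "R (grid \<delta> (K * m)) \<le> R (T n \<omega>)" using work_grid[OF \<delta>0, of "K * m"] by simp
        then show ?thesis by (simp only: work_le_iff epoch_nonneg[OF \<omega>] grid_nonneg[OF \<delta>0])
      qed
      have "R t < R (grid \<delta> (K * m))" using K work_grid[OF \<delta>0, of "K * m"] by simp
      then have "ereal t < ereal (grid \<delta> (K * m))"
        by (simp only: work_less_iff t grid_nonneg[OF \<delta>0] less_ereal.simps)
      also have "\<dots> \<le> D \<omega>" unfolding delay_def using late by (intro Inf_greatest) auto
      finally show "\<omega> \<in> {\<omega> \<in> space M. ereal t < D \<omega>}" using \<omega> by simp
    qed
  qed measurable
  finally show ?thesis .
qed

section \<open>Finiteness of the delay\<close>

lemma eventually_grid_ge:
  assumes "0 < \<delta>" shows "\<exists>k0. \<forall>k\<ge>k0. t0 \<le> grid \<delta> k"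
proof -
  obtain k0 :: nat where k0: "R (max 0 t0) / \<delta> \<le> real k0" using real_arch_simple by blast
  have "t0 \<le> grid \<delta> k" if "k0 \<le> k" for k
  proof -
    have "R (max 0 t0) \<le> real k0 * \<delta>" using k0 assms by (simp add: field_simps)
    also have "\<dots> \<le> real k * \<delta>" using that assms by (intro mult_right_mono) auto
    also have "\<dots> = R (grid \<delta> k)" using assms by (simp add: work_grid)
    finally have "max 0 t0 \<le> grid \<delta> k"
      using assms by (subst (asm) work_le_iff) (auto simp: grid_nonneg)
    then show ?thesis by simp
  qed
  then show ?thesis by blast
qed

lemma eventually_work_gt: "eventually (\<lambda>t. K < R t) at_top"
  using work_diverges by (simp add: filterlim_at_top_dense)

text \<open>The divergence half of the Borel-Cantelli lemma in quantitative form: hitting the first \<open>n\<close> cells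
  from index \<open>k0\<close> on has probability \<open>\<Prod>(1 - p k) \<le> exp (- \<Sum>p k)\<close>, so a positive probability of an
  infinite delay would make the probabilities \<open>p k\<close> of empty cells summable. They dominate a
  power series with exponent \<open>- (c * l) > - 1\<close>.\<close>
theorem delay_finite_if_slow_failures:
  assumes c: "0 < c" "c < 1 / l"
    and ev: "eventually (\<lambda>t. \<mu> / (r t * ln (R t)) < c) at_top"
  shows "AE \<omega> in M. D \<omega> < \<infinity>"
proof -
  have l0: "0 \<le> l" using work_pos by simp
  have "eventually (\<lambda>t. \<mu> / (r t * ln (R t)) < c \<and> 1 < R t) at_top"
    using ev eventually_work_gt by (rule eventually_conj)
  then obtain t0 where t0: "\<And>t. t0 \<le> t \<Longrightarrow> \<mu> / (r t * ln (R t)) < c \<and> 1 < R t"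
    by (auto simp: eventually_at_top_linorder)
  obtain k0 where k0: "\<And>k. k0 \<le> k \<Longrightarrow> t0 \<le> grid l k"
    using eventually_grid_ge[OF work_pos] by blast
  define p where "p k = exp (- \<mu> * (grid l (Suc k) - grid l k))" for k
  define q where "q = prob {\<omega> \<in> space M. D \<omega> = \<infinity>}"
  have p_ge: "(real (Suc k) * l) powr (- (c * l)) \<le> p k" if "k0 \<le> k" for k
  proof -
    obtain \<xi> where \<xi>: "grid l k < \<xi>" "\<xi> < grid l (Suc k)" "grid l (Suc k) - grid l k = real (Suc k - k) * l / r \<xi>"
      by (rule grid_increment[OF work_pos, of k "Suc k"]) auto
    have \<xi>0: "0 < \<xi>" using \<xi>(1) grid_nonneg[OF l0, of k] by simp
    have t: "\<mu> / (r \<xi> * ln (R \<xi>)) < c" "1 < R \<xi>" using t0[of \<xi>] k0[OF that] \<xi>(1) by auto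
    have "R \<xi> < R (grid l (Suc k))" using \<xi>(2) \<xi>0 by (intro work_strict_mono) auto
    then have R\<xi>: "R \<xi> < real (Suc k) * l" using work_grid[OF l0, of "Suc k"] by simp
    have "\<mu> / r \<xi> < c * ln (R \<xi>)" using t rate_positive[OF \<xi>0] by (simp add: field_simps)
    also have "\<dots> \<le> c * ln (real (Suc k) * l)" using t(2) R\<xi> c by (intro mult_left_mono) auto
    finally have "\<mu> / r \<xi> * l \<le> c * ln (real (Suc k) * l) * l"
      using work_pos by (intro mult_right_mono) auto
    then have "- (c * l) * ln (real (Suc k) * l) \<le> - \<mu> * (grid l (Suc k) - grid l k)"
      using \<xi>(3) by (simp add: algebra_simps)
    then show ?thesis
      using work_pos by (simp add: p_def powr_def)
  qed
  have q_le: "q \<le> exp (- (\<Sum>k<n. p (k + k0)))" for n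
  proof -
    obtain t where t: "0 \<le> t" "real (n + k0) * l \<le> R t"
      using grid_nonneg[OF l0, of "n + k0"] work_grid[OF l0, of "n + k0"] by (metis order_refl)
    have "q \<le> prob {\<omega> \<in> space M. ereal t < D \<omega>}"
      unfolding q_def by (rule finite_measure_mono) auto
    also have "\<dots> \<le> (\<Prod>k\<in>{k0..<n + k0}. 1 - p k)"
      unfolding p_def
    proof (rule prob_delay_gt_le)
      show "real k * l \<le> R t" if "k \<in> {k0..<n + k0}" for k
        using that work_pos t(2) by (meson atLeastLessThan_iff less_imp_le mult_right_mono of_nat_le_iff order_trans)
    qed (use t in auto)
    also have "\<dots> \<le> (\<Prod>k\<in>{k0..<n + k0}. exp (- p k))"
    proof (rule prod_mono)
      fix k
      have "grid l k \<le> grid l (Suc k)" using grid_mono[OF l0] by (simp add: mono_def)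
      then have "p k \<le> 1" using rate_pos by (simp add: p_def)
      then show "0 \<le> 1 - p k \<and> 1 - p k \<le> exp (- p k)"
        using exp_ge_add_one_self[of "- p k"] by simp
    qed
    also have "\<dots> = exp (\<Sum>k\<in>{k0..<n + k0}. - p k)" by (simp add: exp_sum)
    also have "(\<Sum>k\<in>{k0..<n + k0}. - p k) = - (\<Sum>k<n. p (k + k0))"
      using sum.shift_bounds_nat_ivl[of p 0 k0 n] by (simp add: sum_negf lessThan_atLeast0)
    finally show ?thesis .
  qed
  have "q = 0"
  proof (rule ccontr)
    assume "q \<noteq> 0"
    then have q: "0 < q" by (simp add: q_def zero_less_measure_iff)
    have "(\<Sum>k<n. p (k + k0)) \<le> - ln q" for n
    proof -
      have "ln q \<le> ln (exp (- (\<Sum>k<n. p (k + k0))))" using q q_le[of n] by (subst ln_le_cancel_iff) auto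
      then show ?thesis by simp
    qed
    then have "summable (\<lambda>k. p (k + k0))"
      by (intro summableI_nonneg_bounded) (auto simp: p_def)
    then have "summable (\<lambda>k. (real (Suc (k + k0)) * l) powr (- (c * l)))"
    proof (rule summable_comparison_test'[where N=0])
      show "norm ((real (Suc (k + k0)) * l) powr (- (c * l))) \<le> p (k + k0)" for k
        using p_ge[of "k + k0"] by simp
    qed
    then have "summable (\<lambda>k. (real (k + Suc k0) * l) powr (- (c * l)))" by simp
    then have "summable (\<lambda>k. (real k * l) powr (- (c * l)))"
      by (subst (asm) summable_iff_shift)
    then have "summable (\<lambda>k. (l powr (c * l)) * (real k * l) powr (- (c * l)))" by (rule summable_mult)
    also have "(\<lambda>k. (l powr (c * l)) * (real k * l) powr (- (c * l))) = (\<lambda>k. real k powr (- (c * l)))"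
      using work_pos by (simp add: powr_mult powr_minus field_simps)
    finally have "c * l > 1" by (simp add: summable_real_powr_iff)
    then show False using c work_pos by (simp add: field_simps)
  qed
  then have "AE \<omega> in M. \<not> D \<omega> = \<infinity>"
    unfolding q_def by (subst (asm) prob_Collect_eq_0) auto
  then show ?thesis by eventually_elim (simp add: less_top[symmetric] top_ereal_def)
qed

text \<open>If the cells before \<open>J\<close> are all hit and no window of \<open>m\<close> consecutive cells from \<open>J\<close> on is empty, then
  there is no long gap at all. By independence, requiring the early cells to be hit multiplies the
  union bound for the windows by \<open>prob head\<close>, so it suffices that the sum of the window
  probabilities from \<open>J\<close> on is below 1.\<close>
theorem delay_infinite_if_fast_failures:
  assumes c: "1 / l < c"
    and ev: "eventually (\<lambda>t. c < \<mu> / (r t * ln (R t))) at_top"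
  shows "0 < prob {\<omega> \<in> space M. D \<omega> = \<infinity>}"
proof -
  have cl: "1 < c * l" using c work_pos by (simp add: field_simps)
  have c0: "0 < c" using c work_pos by (meson less_trans zero_less_divide_1_iff)
  have "((\<lambda>m. c * (real m * (l / real (m + 1)))) \<longlongrightarrow> c * l) sequentially"
    using c0 work_pos by real_asymp
  then have "eventually (\<lambda>m. 1 < c * (real m * (l / real (m + 1)))) sequentially"
    using cl by (rule order_tendstoD)
  then have "eventually (\<lambda>m. 1 \<le> m \<and> 1 < c * (real m * (l / real (m + 1)))) sequentially"
    by (rule eventually_conj[OF eventually_ge_at_top])
  then obtain m where m: "1 \<le> m" "1 < c * (real m * (l / real (m + 1)))"
    using eventually_happens[of _ sequentially] by fastforce
  \<comment> \<open>A window has work \<open>m * \<delta> < l\<close>; \<open>m\<close> is large enough for its exponent \<open>\<alpha>\<close> to stay above 1.\<close>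
  define \<delta> where "\<delta> = l / real (m + 1)"
  define \<alpha> where "\<alpha> = c * (real m * \<delta>)"
  have \<alpha>: "1 < \<alpha>" using m by (simp add: \<alpha>_def \<delta>_def)
  have \<delta>0: "0 < \<delta>" using work_pos by (simp add: \<delta>_def)
  have \<delta>1: "0 \<le> \<delta>" using \<delta>0 by simp
  have "eventually (\<lambda>t. c < \<mu> / (r t * ln (R t)) \<and> 1 < R t) at_top"
    using ev eventually_work_gt by (rule eventually_conj)
  then obtain t0 where t0: "\<And>t. t0 \<le> t \<Longrightarrow> c < \<mu> / (r t * ln (R t)) \<and> 1 < R t"
    by (auto simp: eventually_at_top_linorder)
  obtain j0 where j0: "\<And>j. j0 \<le> j \<Longrightarrow> t0 \<le> grid \<delta> j"
    using eventually_grid_ge[OF \<delta>0] by blast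
  define g where "g j = (real j * \<delta>) powr (- \<alpha>)" for j
  have window: "exp (- \<mu> * (grid \<delta> (j + m) - grid \<delta> j)) \<le> g j" if "j0 \<le> j" "1 \<le> j" for j
  proof -
    obtain \<xi> where \<xi>: "grid \<delta> j < \<xi>" "\<xi> < grid \<delta> (j + m)" "grid \<delta> (j + m) - grid \<delta> j = real (j + m - j) * \<delta> / r \<xi>"
      by (rule grid_increment[OF \<delta>0, of j "j + m"]) (use m in auto)
    have \<xi>0: "0 < \<xi>" using \<xi>(1) grid_nonneg[OF \<delta>1, of j] by simp
    have t: "c < \<mu> / (r \<xi> * ln (R \<xi>))" "1 < R \<xi>" using t0[of \<xi>] j0[OF that(1)] \<xi>(1) by auto
    have "R (grid \<delta> j) < R \<xi>" using \<xi>(1) grid_nonneg[OF \<delta>1] by (intro work_strict_mono) auto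
    then have R\<xi>: "real j * \<delta> < R \<xi>" using work_grid[OF \<delta>1, of j] by simp
    have j\<delta>: "0 < real j * \<delta>" using that \<delta>0 by simp
    have "c * ln (real j * \<delta>) \<le> c * ln (R \<xi>)" using R\<xi> c0 j\<delta> by (intro mult_left_mono) auto
    also have "\<dots> \<le> \<mu> / r \<xi>" using t rate_positive[OF \<xi>0] by (simp add: field_simps)
    finally have "c * ln (real j * \<delta>) * (real m * \<delta>) \<le> \<mu> / r \<xi> * (real m * \<delta>)"
      using \<delta>0 by (intro mult_right_mono) auto
    then have "- \<mu> * (grid \<delta> (j + m) - grid \<delta> j) \<le> - \<alpha> * ln (real j * \<delta>)"
      using \<xi>(3) by (simp add: algebra_simps \<alpha>_def)
    then show ?thesis using that(2) \<delta>0 by (simp add: g_def powr_def)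
  qed
  have "summable (\<lambda>j. \<delta> powr (- \<alpha>) * real j powr (- \<alpha>))"
    using \<alpha> by (intro summable_mult) (simp add: summable_real_powr_iff)
  also have "(\<lambda>j. \<delta> powr (- \<alpha>) * real j powr (- \<alpha>)) = g"
    using \<delta>0 by (auto simp: g_def powr_mult)
  finally have g: "summable g" .
  then obtain J1 where J1: "\<And>n. J1 \<le> n \<Longrightarrow> norm (\<Sum>i. g (i + n)) < 1"
    using suminf_exist_split[of 1 g] by auto
  define J where "J = max 1 (max j0 J1)"
  have J: "J1 \<le> J" "j0 \<le> J" "1 \<le> J" by (auto simp: J_def)
  have tail: "(\<Sum>i. g (i + J)) < 1" using J1[OF J(1)] by simp
  define head where "head = {\<omega> \<in> space M. \<forall>i\<in>{..<J}. \<omega> \<notin> void (cell \<delta> i)}"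
  define bad where "bad j = {\<omega> \<in> space M. (\<forall>i\<in>{..<J}. \<omega> \<notin> void (cell \<delta> i)) \<and> (\<forall>i\<in>{j..<j + m}. \<omega> \<in> void (cell \<delta> i))}" for j
  have head_meas: "head \<in> sets M" and bad_meas: "bad j \<in> sets M" for j
    unfolding head_def bad_def by measurable
  have head_eq: "prob head = (\<Prod>i<J. 1 - exp (- \<mu> * (grid \<delta> (Suc i) - grid \<delta> i)))"
    using prob_cells_hit_and_void[OF grid_mono[OF \<delta>1] grid_nonneg[OF \<delta>1], of "{..<J}" "{}"] by (simp add: head_def)
  have grid_less: "grid \<delta> i < grid \<delta> (Suc i)" for i
    using grid_increment[OF \<delta>0, of i "Suc i"] by (metis lessI less_trans)
  have head_pos: "0 < prob head"
    unfolding head_eq using grid_less rate_pos by (intro prod_pos) (simp add: mult_pos_pos)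
  have bad_le: "prob (bad j) \<le> prob head * g j" if "J \<le> j" for j
  proof -
    have "prob (bad j) = prob head * (\<Prod>i\<in>{j..<j + m}. exp (- \<mu> * (grid \<delta> (Suc i) - grid \<delta> i)))"
      unfolding bad_def head_eq
      using that by (intro prob_cells_hit_and_void[OF grid_mono[OF \<delta>1] grid_nonneg[OF \<delta>1]]) auto
    also have "(\<Prod>i\<in>{j..<j + m}. exp (- \<mu> * (grid \<delta> (Suc i) - grid \<delta> i)))
       = exp (- \<mu> * (\<Sum>i\<in>{j..<j + m}. grid \<delta> (Suc i) - grid \<delta> i))"
      by (simp add: exp_sum[symmetric] sum_distrib_left)
    also have "(\<Sum>i\<in>{j..<j + m}. grid \<delta> (Suc i) - grid \<delta> i) = grid \<delta> (j + m) - grid \<delta> j"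
      by (rule sum_Suc_diff') simp
    also have "prob head * exp (- \<mu> * (grid \<delta> (j + m) - grid \<delta> j)) \<le> prob head * g j"
      using that window[of j] J by (intro mult_left_mono) auto
    finally show ?thesis .
  qed
  have gJ: "summable (\<lambda>i. g (i + J))" using g by (rule summable_ignore_initial_segment)
  have bad_sum: "summable (\<lambda>i. prob (bad (i + J)))"
    by (rule summable_comparison_test'[OF summable_mult[OF gJ, of "prob head"], where N=0])
       (use bad_le in auto)
  have "prob (\<Union>i. bad (i + J)) \<le> (\<Sum>i. prob (bad (i + J)))"
    using bad_meas bad_sum by (intro finite_measure_subadditive_countably) auto
  also have "\<dots> \<le> (\<Sum>i. prob head * g (i + J))"
    using bad_le by (intro suminf_le bad_sum summable_mult gJ) auto
  also have "\<dots> = prob head * (\<Sum>i. g (i + J))" by (rule suminf_mult[OF gJ])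
  also have "\<dots> < prob head * 1" using tail head_pos by (intro mult_strict_left_mono)
  finally have less: "prob (\<Union>i. bad (i + J)) < prob head" by simp
  have "0 < prob head - prob (\<Union>i. bad (i + J))" using less by simp
  also have "\<dots> = prob (head - (\<Union>i. bad (i + J)))"
    using head_meas bad_meas by (subst finite_measure_Diff) (auto simp: bad_def head_def)
  also have "\<dots> \<le> prob {\<omega> \<in> space M. D \<omega> = \<infinity>}"
  proof (rule finite_measure_mono)
    show "head - (\<Union>i. bad (i + J)) \<subseteq> {\<omega> \<in> space M. D \<omega> = \<infinity>}"
    proof
      fix \<omega> assume \<omega>: "\<omega> \<in> head - (\<Union>i. bad (i + J))"
      then have sp: "\<omega> \<in> space M" by (simp add: head_def)
      have "\<not> l \<le> R (T (Suc n) \<omega>) - R (T n \<omega>)" for n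
      proof
        assume "l \<le> R (T (Suc n) \<omega>) - R (T n \<omega>)"
        then obtain i where i: "\<And>j. i \<le> j \<Longrightarrow> j < i + m \<Longrightarrow> \<omega> \<in> void (cell \<delta> j)"
          using void_window_in_long_gap[OF sp \<delta>_def] by metis
        show False
        proof (cases "i < J")
          case True
          then show False using i[of i] m \<omega> by (auto simp: head_def)
        next
          case False
          then have "\<omega> \<in> bad ((i - J) + J)" using \<omega> i by (auto simp: head_def bad_def)
          then show False using \<omega> by blast
        qed
      qed
      then have "D \<omega> = \<infinity>" by (simp add: delay_def top_ereal_def)
      then show "\<omega> \<in> {\<omega> \<in> space M. D \<omega> = \<infinity>}" using sp by simp
    qed
  qed measurable
  finally show ?thesis .
qed

end

section \<open>Logarithmic tail asymptotics for power rates\<close>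

locale power_rate_task = restarted_task r M T \<mu> l
  for r :: "real \<Rightarrow> real" and M :: "'a measure" and T :: "nat \<Rightarrow> 'a \<Rightarrow> real" and \<mu> l :: real +
  fixes a b :: real
  assumes a_pos: "0 < a" and b_pos: "0 < b" and power_rate: "\<And>t. 0 \<le> t \<Longrightarrow> r t = a * t powr b"
begin

lemma work_power:
  assumes "0 \<le> t" shows "R t = a / (b + 1) * t powr (b + 1)"
proof -
  let ?F = "\<lambda>t. a / (b + 1) * t powr (b + 1)"
  have "(r has_integral (?F t - ?F 0)) {0..t}"
  proof (rule fundamental_theorem_of_calculus_interior[OF assms])
    show "continuous_on {0..t} ?F"
      using b_pos by (intro continuous_on_mult continuous_on_const continuous_on_powr' continuous_on_id) auto
    show "(?F has_vector_derivative r x) (at x)" if "x \<in> {0<..<t}" for x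
    proof -
      have "(?F has_real_derivative a / (b + 1) * ((b + 1) * x powr (b + 1 - 1))) (at x)"
        using that by (intro DERIV_cmult has_real_derivative_powr) auto
      moreover have "a / (b + 1) * ((b + 1) * x powr (b + 1 - 1)) = r x"
        using that b_pos by (simp add: power_rate)
      ultimately show ?thesis by (simp add: has_real_derivative_iff_has_vector_derivative)
    qed
  qed
  then show ?thesis using b_pos by (simp add: cumulative_work_def integral_unique)
qed

lemma rate_mono: "0 \<le> s \<Longrightarrow> s \<le> t \<Longrightarrow> r s \<le> r t"
  using a_pos b_pos by (simp add: power_rate powr_mono2)

text \<open>The decay exponent of both tails; for \<open>t \<ge> 0\<close> it equals \<open>R t / l * (b * ln t)\<close>.\<close>
definition tail_rate :: "real \<Rightarrow> real" where
  "tail_rate t = a * b / (b + 1) * t powr (b + 1) * ln t / l"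

lemma eventually_tail_rate_pos: "eventually (\<lambda>t. 0 < tail_rate t) at_top"
  using eventually_gt_at_top[of 1]
proof eventually_elim
  case (elim t)
  then show ?case using a_pos b_pos work_pos by (simp add: tail_rate_def)
qed

abbreviation delay_tail :: "real \<Rightarrow> real" where
  "delay_tail t \<equiv> prob {\<omega> \<in> space M. ereal t < D \<omega>}"

abbreviation task_tail :: "real \<Rightarrow> real" where
  "task_tail t \<equiv> prob {\<omega> \<in> space M. ereal t < X \<omega>}"

text \<open>The rate increases, so the last cells are the ones least likely to be hit. Bounding every factor
  by one for the rate at \<open>t + 1\<close> loses nothing on the logarithmic scale. The summand 2 accounts for
  rounding and for the cell with index 0.\<close>
lemma delay_tail_lower:
  assumes m: "1 \<le> m"
  defines "\<delta> \<equiv> l / real (m + 1)"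
  shows "eventually (\<lambda>t. 0 < delay_tail t \<and>
    - ln (delay_tail t) \<le> (R t / (real m * \<delta>) + 2) * (- ln (1 - exp (- \<mu> * (\<delta> / r (t + 1)))))) at_top"
proof -
  have \<delta>0: "0 < \<delta>" and \<delta>1: "0 \<le> \<delta>" using work_pos by (auto simp: \<delta>_def)
  have "eventually (\<lambda>t. l < a * t powr b) at_top"
    using a_pos b_pos by real_asymp
  then show ?thesis using eventually_gt_at_top[of 0]
  proof eventually_elim
    case (elim t)
    define \<phi> where "\<phi> = 1 - exp (- \<mu> * (\<delta> / r (t + 1)))"
    define K where "K = Suc (nat \<lfloor>R t / (real m * \<delta>)\<rfloor>)"
    have m\<delta>: "0 < real m * \<delta>" using m \<delta>0 by simp
    have R0: "0 \<le> R t / (real m * \<delta>)" using work_nonneg[of t] m\<delta> by simp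
    have K: "R t / (real m * \<delta>) < real K" "real K \<le> R t / (real m * \<delta>) + 1"
      using R0 unfolding K_def by linarith+
    have Klo: "R t < real (K * m) * \<delta>" using K(1) m\<delta> by (simp add: field_simps)
    have Khi: "real (K * m + 1) * \<delta> \<le> R t + l"
    proof -
      have "real K - 1 \<le> R t / (real m * \<delta>)" using K(2) by simp
      then have "(real K - 1) * (real m * \<delta>) \<le> R t" by (simp only: pos_le_divide_eq[OF m\<delta>])
      moreover have "real (m + 1) * \<delta> = l"
        unfolding \<delta>_def by (simp only: times_divide_eq_right, rule nonzero_mult_div_cancel_left) simp
      ultimately show ?thesis by (simp add: algebra_simps)
    qed
    obtain \<eta> where \<eta>: "t < \<eta>" "R (t + 1) - R t = (t + 1 - t) * r \<eta>"
      using work_increment[of t "t + 1"] elim by (metis less_add_one less_imp_le)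
    have "r t \<le> r \<eta>" using \<eta> elim by (intro rate_mono) auto
    then have grow: "R t + l < R (t + 1)" using \<eta>(2) elim power_rate[of t] by simp
    have rpos: "0 < r (t + 1)" using elim by (intro rate_positive) auto
    have \<phi>: "0 < \<phi>" "\<phi> \<le> 1" using rpos rate_pos \<delta>0 by (auto simp: \<phi>_def)
    have factor: "\<phi> \<le> 1 - exp (- \<mu> * (grid \<delta> (Suc (k * m)) - grid \<delta> (k * m)))" if "k \<le> K" for k
    proof -
      obtain \<xi> where \<xi>: "grid \<delta> (k * m) < \<xi>" "\<xi> < grid \<delta> (Suc (k * m))"
          "grid \<delta> (Suc (k * m)) - grid \<delta> (k * m) = real (Suc (k * m) - k * m) * \<delta> / r \<xi>"
        by (rule grid_increment[OF \<delta>0, of "k * m" "Suc (k * m)"]) auto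
      have \<xi>0: "0 < \<xi>" using \<xi>(1) grid_nonneg[OF \<delta>1, of "k * m"] by simp
      have "k * m \<le> K * m" using that by simp
      then have "real (Suc (k * m)) * \<delta> \<le> real (K * m + 1) * \<delta>"
        using \<delta>1 by (intro mult_right_mono of_nat_mono) simp_all
      then have "R (grid \<delta> (Suc (k * m))) \<le> real (K * m + 1) * \<delta>" by (simp only: work_grid[OF \<delta>1])
      then have "R (grid \<delta> (Suc (k * m))) < R (t + 1)" using Khi grow by simp
      then have "grid \<delta> (Suc (k * m)) < t + 1"
        using work_less_iff[of "grid \<delta> (Suc (k * m))" "t + 1"] grid_nonneg[OF \<delta>1] elim by simp
      then have "r \<xi> \<le> r (t + 1)" using \<xi>(2) \<xi>0 by (intro rate_mono) auto
      then have "\<delta> / r (t + 1) \<le> \<delta> / r \<xi>"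
        using \<delta>0 rate_positive[OF \<xi>0] by (intro divide_left_mono mult_pos_pos rpos) auto
      also have "\<dots> = grid \<delta> (Suc (k * m)) - grid \<delta> (k * m)" using \<xi>(3) by simp
      finally have "\<mu> * (\<delta> / r (t + 1)) \<le> \<mu> * (grid \<delta> (Suc (k * m)) - grid \<delta> (k * m))"
        using rate_pos by (intro mult_left_mono) auto
      then show ?thesis by (simp only: \<phi>_def mult_minus_left exp_le_cancel_iff neg_le_iff_le diff_left_mono)
    qed
    have "\<phi> ^ Suc K = (\<Prod>k\<le>K. \<phi>)" by simp
    also have "\<dots> \<le> (\<Prod>k\<le>K. 1 - exp (- \<mu> * (grid \<delta> (Suc (k * m)) - grid \<delta> (k * m))))"
      using factor \<phi> by (intro prod_mono) auto
    also have "\<dots> \<le> delay_tail t"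
      using elim by (intro prob_delay_gt_ge[OF m _ _ Klo]) (auto simp: \<delta>_def)
    finally have le: "\<phi> ^ Suc K \<le> delay_tail t" .
    have pos: "0 < \<phi> ^ Suc K" using \<phi> by (intro zero_less_power)
    have tpos: "0 < delay_tail t" using le pos by linarith
    have "real (Suc K) * ln \<phi> = ln (\<phi> ^ Suc K)" using \<phi> by (subst ln_realpow) auto
    also have "\<dots> \<le> ln (delay_tail t)" using le pos by (intro ln_mono)
    finally have "- ln (delay_tail t) \<le> real (Suc K) * (- ln \<phi>)" by simp
    also have "\<dots> \<le> (R t / (real m * \<delta>) + 2) * (- ln \<phi>)"
      using K(2) \<phi> by (intro mult_right_mono) auto
    finally show ?case using tpos by (simp only: \<phi>_def)
  qed
qed

text \<open>Cells before time \<open>\<kappa> * t\<close> are discarded. The remaining ones are still hit with probability at most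
  \<open>\<mu> * l / r (\<kappa> * t)\<close> each, and their number is a fraction close to 1 of \<open>R t / l\<close> when \<open>\<kappa>\<close> is small.
  The 2 accounts for the partial cells at both ends.\<close>
lemma delay_tail_upper:
  assumes \<kappa>: "0 < \<kappa>" "\<kappa> < 1"
  shows "eventually (\<lambda>t. 0 < delay_tail t \<longrightarrow>
    ((R t - R (\<kappa> * t)) / l - 2) * (- ln (\<mu> * l / r (\<kappa> * t))) \<le> - ln (delay_tail t)) at_top"
proof -
  have l0: "0 \<le> l" using work_pos by simp
  have "eventually (\<lambda>t. \<mu> * l < a * (\<kappa> * t) powr b) at_top"
    using a_pos b_pos \<kappa> by real_asymp
  then show ?thesis using eventually_gt_at_top[of 0]
  proof eventually_elim
    case (elim t)
    define x where "x = \<mu> * l / r (\<kappa> * t)"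
    define m where "m = nat \<lceil>R (\<kappa> * t) / l\<rceil>"
    define K where "K = nat \<lfloor>R t / l\<rfloor>"
    have R0: "0 \<le> R (\<kappa> * t) / l" "0 \<le> R t / l" using work_nonneg work_pos by auto
    have m: "R (\<kappa> * t) / l \<le> real m" "real m \<le> R (\<kappa> * t) / l + 1"
      using R0 unfolding m_def by linarith+
    have K: "R t / l - 1 \<le> real K" "real K \<le> R t / l" using R0 unfolding K_def by linarith+
    have \<kappa>t: "0 < \<kappa> * t" using \<kappa> elim by simp
    have rpos: "0 < r (\<kappa> * t)" using \<kappa>t by (rule rate_positive)
    have x: "0 < x" "x < 1"
      using rpos rate_pos work_pos elim power_rate[of "\<kappa> * t"] \<kappa>t by (auto simp: x_def)
    have factor: "1 - exp (- \<mu> * (grid l (Suc k) - grid l k)) \<le> x" if "m \<le> k" for k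
    proof -
      obtain \<xi> where \<xi>: "grid l k < \<xi>" "grid l (Suc k) - grid l k = real (Suc k - k) * l / r \<xi>"
        by (rule grid_increment[OF work_pos, of k "Suc k"]) auto
      have "R (\<kappa> * t) \<le> real m * l" using m(1) work_pos by (simp add: field_simps)
      also have "\<dots> \<le> real k * l" using that l0 by (intro mult_right_mono) auto
      also have "\<dots> = R (grid l k)" by (simp add: work_grid[OF l0])
      finally have "\<kappa> * t \<le> grid l k"
        using work_le_iff[of "\<kappa> * t" "grid l k"] grid_nonneg[OF l0, of k] \<kappa>t by simp
      then have "r (\<kappa> * t) \<le> r \<xi>" using \<xi>(1) \<kappa>t by (intro rate_mono) auto
      then have "l / r \<xi> \<le> l / r (\<kappa> * t)"
        using rpos l0 by (intro divide_left_mono mult_pos_pos) auto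
      then have "\<mu> * (l / r \<xi>) \<le> \<mu> * (l / r (\<kappa> * t))"
        using rate_pos by (intro mult_left_mono) auto
      then have "\<mu> * (grid l (Suc k) - grid l k) \<le> x" using \<xi>(2) by (simp add: x_def)
      moreover have "1 - exp (- \<mu> * (grid l (Suc k) - grid l k)) \<le> \<mu> * (grid l (Suc k) - grid l k)"
        using exp_ge_add_one_self[of "- \<mu> * (grid l (Suc k) - grid l k)"] by simp
      ultimately show ?thesis by simp
    qed
    have "delay_tail t \<le> (\<Prod>k\<in>{m..<K}. 1 - exp (- \<mu> * (grid l (Suc k) - grid l k)))"
    proof (rule prob_delay_gt_le)
      fix k assume "k \<in> {m..<K}"
      then have "real k * l \<le> real K * l" using l0 by (intro mult_right_mono) auto
      also have "\<dots> \<le> R t" using K(2) work_pos by (simp add: field_simps)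
      finally show "real k * l \<le> R t" .
    qed (use elim in auto)
    also have "\<dots> \<le> (\<Prod>k\<in>{m..<K}. x)"
    proof (rule prod_mono)
      fix k assume "k \<in> {m..<K}"
      moreover have "grid l k \<le> grid l (Suc k)" using grid_mono[OF l0] by (simp add: mono_def)
      ultimately show "0 \<le> 1 - exp (- \<mu> * (grid l (Suc k) - grid l k)) \<and>
          1 - exp (- \<mu> * (grid l (Suc k) - grid l k)) \<le> x"
        using factor rate_pos by auto
    qed
    also have "\<dots> = x ^ (K - m)" by simp
    finally have le: "delay_tail t \<le> x ^ (K - m)" .
    show ?case
    proof
      assume pos: "0 < delay_tail t"
      have "(R t - R (\<kappa> * t)) / l - 2 \<le> real (K - m)"
        using m K by (simp add: diff_divide_distrib)
      then have "((R t - R (\<kappa> * t)) / l - 2) * (- ln x) \<le> real (K - m) * (- ln x)"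
        using x by (intro mult_right_mono) auto
      also have "\<dots> = - ln (x ^ (K - m))" using x by (subst ln_realpow) auto
      also have "\<dots> \<le> - ln (delay_tail t)" using ln_mono[OF le pos] by simp
      finally show "((R t - R (\<kappa> * t)) / l - 2) * (- ln (\<mu> * l / r (\<kappa> * t))) \<le> - ln (delay_tail t)"
        by (simp only: x_def)
    qed
  qed
qed

lemma tail_lower_limit:
  assumes m: "1 \<le> m"
  defines "\<delta> \<equiv> l / real (m + 1)"
  shows "((\<lambda>t. (R t / (real m * \<delta>) + 2) * (- ln (1 - exp (- \<mu> * (\<delta> / r (t + 1))))) / tail_rate t)
     \<longlongrightarrow> l / (real m * \<delta>)) at_top"
proof -
  have \<delta>: "0 < \<delta>" using work_pos by (simp add: \<delta>_def)
  have m0: "0 < real m" using m by simp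
  define M' where "M' = real m * \<delta>"
  have M': "0 < M'" using m0 \<delta> by (simp add: M'_def)
  have "((\<lambda>t. (C * t powr B / M' + 2) / (C * t powr B / l)) \<longlongrightarrow> l / M') at_top"
    if "0 < C" "0 < B" for B C
  proof -
    have "C * inverse M' * (inverse C * l) = l / M'" using that by (simp add: field_simps)
    moreover have "((\<lambda>t. (C * t powr B / M' + 2) / (C * t powr B / l)) \<longlongrightarrow> C * inverse M' * (inverse C * l)) at_top"
      using that work_pos M' by real_asymp
    ultimately show ?thesis by (simp only:)
  qed
  from this[of "a / (b + 1)" "b + 1"]
  have 1: "((\<lambda>t. (a / (b + 1) * t powr (b + 1) / M' + 2) / (a / (b + 1) * t powr (b + 1) / l)) \<longlongrightarrow> l / M') at_top"
    using a_pos b_pos by simp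
  have 2: "((\<lambda>t. - ln (1 - exp (- \<mu> * (\<delta> / (a * (t + 1) powr b)))) / (b * ln t)) \<longlongrightarrow> 1) at_top"
    using a_pos b_pos \<delta> rate_pos by real_asymp
  have "((\<lambda>t. (a / (b + 1) * t powr (b + 1) / M' + 2) / (a / (b + 1) * t powr (b + 1) / l) *
      (- ln (1 - exp (- \<mu> * (\<delta> / (a * (t + 1) powr b)))) / (b * ln t))) \<longlongrightarrow> l / M' * 1) at_top"
    by (rule tendsto_mult[OF 1 2])
  moreover have "eventually (\<lambda>t. (a / (b + 1) * t powr (b + 1) / M' + 2) / (a / (b + 1) * t powr (b + 1) / l) *
      (- ln (1 - exp (- \<mu> * (\<delta> / (a * (t + 1) powr b)))) / (b * ln t)) =
      (R t / (real m * \<delta>) + 2) * (- ln (1 - exp (- \<mu> * (\<delta> / r (t + 1))))) / tail_rate t) at_top"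
    using eventually_gt_at_top[of 0]
    by eventually_elim (simp add: work_power power_rate M'_def tail_rate_def mult_ac)
  ultimately show ?thesis
    unfolding M'_def mult_1_right by (rule Lim_transform_eventually)
qed

lemma tail_upper_limit:
  assumes \<kappa>: "0 < \<kappa>" "\<kappa> < 1"
  shows "((\<lambda>t. ((R t - R (\<kappa> * t)) / l - 2) * (- ln (\<mu> * l / r (\<kappa> * t))) / tail_rate t)
     \<longlongrightarrow> 1 - \<kappa> powr (b + 1)) at_top"
proof -
  have 1: "((\<lambda>t. 1 - \<kappa> powr (b + 1) - 2 / (a / (b + 1) * t powr (b + 1) / l)) \<longlongrightarrow> 1 - \<kappa> powr (b + 1)) at_top"
    using a_pos b_pos work_pos by real_asymp
  have 2: "((\<lambda>t. - ln (\<mu> * l / (a * (\<kappa> * t) powr b)) / (b * ln t)) \<longlongrightarrow> 1) at_top"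
    using a_pos b_pos work_pos rate_pos \<kappa> by real_asymp
  have "((\<lambda>t. (1 - \<kappa> powr (b + 1) - 2 / (a / (b + 1) * t powr (b + 1) / l)) *
      (- ln (\<mu> * l / (a * (\<kappa> * t) powr b)) / (b * ln t))) \<longlongrightarrow> (1 - \<kappa> powr (b + 1)) * 1) at_top"
    by (rule tendsto_mult[OF 1 2])
  moreover have "eventually (\<lambda>t. (1 - \<kappa> powr (b + 1) - 2 / (a / (b + 1) * t powr (b + 1) / l)) *
      (- ln (\<mu> * l / (a * (\<kappa> * t) powr b)) / (b * ln t)) =
      ((R t - R (\<kappa> * t)) / l - 2) * (- ln (\<mu> * l / r (\<kappa> * t))) / tail_rate t) at_top"
    using eventually_gt_at_top[of 0]
  proof eventually_elim
    case (elim t)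
    define W where "W = a / (b + 1) * t powr (b + 1) / l"
    have W: "0 < W" using elim a_pos b_pos work_pos by (simp add: W_def)
    have work_part: "(R t - R (\<kappa> * t)) / l - 2 = (1 - \<kappa> powr (b + 1) - 2 / W) * W"
      using elim \<kappa> work_pos b_pos W by (simp add: work_power powr_mult W_def[symmetric] left_diff_distrib)
         (simp add: W_def diff_divide_distrib mult_ac)
    have rate_part: "r (\<kappa> * t) = a * (\<kappa> * t) powr b" using elim \<kappa> by (simp add: power_rate)
    have scale: "tail_rate t = W * (b * ln t)" by (simp add: tail_rate_def W_def)
    show ?case
      unfolding work_part rate_part scale W_def[symmetric] using W by simp
  qed
  ultimately show ?thesis unfolding mult_1_right by (rule Lim_transform_eventually)
qed

lemma eventually_delay_tail_pos: "eventually (\<lambda>t. 0 < delay_tail t) at_top"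
  using delay_tail_lower[of 1] by (auto elim: eventually_mono)

text \<open>The limits of the two bounds are \<open>1 - \<kappa> powr (b + 1)\<close> and \<open>(m + 1) / m\<close>, which approach 1 from
  either side as \<open>\<kappa>\<close> tends to 0 and \<open>m\<close> to infinity.\<close>
theorem delay_tail_log_asymptotics: "((\<lambda>t. - ln (delay_tail t) / tail_rate t) \<longlongrightarrow> 1) at_top"
proof (rule order_tendstoI)
  fix y :: real assume y: "y < 1"
  have "((\<lambda>\<kappa>. 1 - \<kappa> powr (b + 1)) \<longlongrightarrow> 1) (at_right 0)"
    using b_pos by real_asymp
  then have "eventually (\<lambda>\<kappa>. y < 1 - \<kappa> powr (b + 1)) (at_right 0)" using y by (rule order_tendstoD)
  moreover have "eventually (\<lambda>\<kappa>::real. \<kappa> \<in> {0<..<1}) (at_right 0)"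
    by (rule eventually_at_right_real) simp
  ultimately have "eventually (\<lambda>\<kappa>. y < 1 - \<kappa> powr (b + 1) \<and> \<kappa> \<in> {0<..<1}) (at_right 0)"
    by (rule eventually_conj)
  from eventually_happens'[OF _ this] obtain \<kappa> where \<kappa>: "0 < \<kappa>" "\<kappa> < 1" "y < 1 - \<kappa> powr (b + 1)"
    by auto
  have "eventually (\<lambda>t. y < ((R t - R (\<kappa> * t)) / l - 2) * (- ln (\<mu> * l / r (\<kappa> * t))) / tail_rate t) at_top"
    using tail_upper_limit[OF \<kappa>(1,2)] \<kappa>(3) by (rule order_tendstoD)
  then show "eventually (\<lambda>t. y < - ln (delay_tail t) / tail_rate t) at_top"
    using delay_tail_upper[OF \<kappa>(1,2)] eventually_tail_rate_pos eventually_delay_tail_pos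
  proof eventually_elim
    case (elim t)
    have "((R t - R (\<kappa> * t)) / l - 2) * (- ln (\<mu> * l / r (\<kappa> * t))) / tail_rate t \<le> - ln (delay_tail t) / tail_rate t"
      using elim by (intro divide_right_mono) auto
    then show ?case using elim(1) by linarith
  qed
next
  fix y :: real assume y: "1 < y"
  have "((\<lambda>m. l / (real m * (l / real (m + 1)))) \<longlongrightarrow> 1) sequentially"
    using work_pos by real_asymp
  then have "eventually (\<lambda>m. l / (real m * (l / real (m + 1))) < y) sequentially" using y by (rule order_tendstoD)
  then have "eventually (\<lambda>m. 1 \<le> m \<and> l / (real m * (l / real (m + 1))) < y) sequentially"
    by (rule eventually_conj[OF eventually_ge_at_top])
  then obtain m where m: "1 \<le> m" "l / (real m * (l / real (m + 1))) < y"
    using eventually_happens[of _ sequentially] by fastforce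
  define \<delta> where "\<delta> = l / real (m + 1)"
  have "eventually (\<lambda>t. (R t / (real m * \<delta>) + 2) * (- ln (1 - exp (- \<mu> * (\<delta> / r (t + 1))))) / tail_rate t < y) at_top"
    unfolding \<delta>_def using tail_lower_limit[OF m(1)] m(2) by (rule order_tendstoD)
  then show "eventually (\<lambda>t. - ln (delay_tail t) / tail_rate t < y) at_top"
    using delay_tail_lower[OF m(1), folded \<delta>_def] eventually_tail_rate_pos
  proof eventually_elim
    case (elim t)
    have "- ln (delay_tail t) / tail_rate t \<le> (R t / (real m * \<delta>) + 2) * (- ln (1 - exp (- \<mu> * (\<delta> / r (t + 1))))) / tail_rate t"
      using elim by (intro divide_right_mono) auto
    then show ?case using elim(1) by linarith
  qed
qed

lemma delay_tail_antimono: "s \<le> t \<Longrightarrow> delay_tail t \<le> delay_tail s"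
  by (rule finite_measure_mono) (auto intro: le_less_trans[of "ereal s" "ereal t"])

text \<open>By time \<open>t - 1\<close> at least \<open>l\<close> less work has been done than by time \<open>t\<close> once the rate exceeds \<open>l\<close>, so a
  task time beyond \<open>t\<close> forces a delay beyond \<open>t - 1\<close>.\<close>
lemma task_tail_bounds:
  "eventually (\<lambda>t. delay_tail t \<le> task_tail t \<and> task_tail t \<le> delay_tail (t - 1)) at_top"
proof -
  have "eventually (\<lambda>t. l < a * (t - 1) powr b) at_top"
    using a_pos b_pos by real_asymp
  then show ?thesis using eventually_gt_at_top[of 1] eventually_work_gt[of l]
  proof eventually_elim
    case (elim t)
    have eq: "{\<omega> \<in> space M. ereal t < X \<omega>} = {\<omega> \<in> space M. ereal (R_inv (R t - l)) < D \<omega>}"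
      using elim by (intro Collect_cong conj_cong refl task_time_greater_iff) auto
    have up: "R_inv (R t - l) \<le> t"
      using elim work_pos inverse_work_less_iff[of "R t - l" t] by simp
    obtain \<eta> where \<eta>: "t - 1 < \<eta>" "R t - R (t - 1) = (t - (t - 1)) * r \<eta>"
      by (rule work_increment[of "t - 1" t]) (use elim in auto)
    have "r (t - 1) \<le> r \<eta>" using \<eta> elim by (intro rate_mono) auto
    then have "R (t - 1) < R t - l" using \<eta>(2) elim power_rate[of "t - 1"] by simp
    then have lo: "t - 1 \<le> R_inv (R t - l)"
      using elim less_inverse_work_iff[of "R t - l" "t - 1"] by simp
    have "delay_tail t \<le> task_tail t"
      unfolding eq using up by (rule delay_tail_antimono)
    moreover have "task_tail t \<le> delay_tail (t - 1)"
      unfolding eq using lo by (rule delay_tail_antimono)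
    ultimately show ?case by simp
  qed
qed

theorem task_tail_log_asymptotics: "((\<lambda>t. - ln (task_tail t) / tail_rate t) \<longlongrightarrow> 1) at_top"
proof (rule tendsto_sandwich[OF _ _ _ delay_tail_log_asymptotics])
  have shift: "filterlim (\<lambda>t. t - 1 :: real) at_top at_top" by real_asymp
  have "((\<lambda>t. - ln (delay_tail (t - 1)) / tail_rate (t - 1) * (tail_rate (t - 1) / tail_rate t)) \<longlongrightarrow> 1 * 1) at_top"
  proof (rule tendsto_mult)
    show "((\<lambda>t. - ln (delay_tail (t - 1)) / tail_rate (t - 1)) \<longlongrightarrow> 1) at_top"
      using filterlim_compose[OF delay_tail_log_asymptotics shift] .
    show "((\<lambda>t. tail_rate (t - 1) / tail_rate t) \<longlongrightarrow> 1) at_top"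
      unfolding tail_rate_def using a_pos b_pos work_pos by real_asymp
  qed
  moreover have "eventually (\<lambda>t. - ln (delay_tail (t - 1)) / tail_rate (t - 1) * (tail_rate (t - 1) / tail_rate t)
      = - ln (delay_tail (t - 1)) / tail_rate t) at_top"
    using filterlim_iff[THEN iffD1, OF shift, rule_format, OF eventually_tail_rate_pos]
    by eventually_elim simp
  ultimately show "((\<lambda>t. - ln (delay_tail (t - 1)) / tail_rate t) \<longlongrightarrow> 1) at_top"
    unfolding mult_1_right by (rule Lim_transform_eventually)
  show "eventually (\<lambda>t. - ln (delay_tail (t - 1)) / tail_rate t \<le> - ln (task_tail t) / tail_rate t) at_top"
    using task_tail_bounds eventually_delay_tail_pos eventually_tail_rate_pos
  proof eventually_elim
    case (elim t)
    have "ln (task_tail t) \<le> ln (delay_tail (t - 1))" using elim by (intro ln_mono) auto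
    then show ?case using elim by (intro divide_right_mono) auto
  qed
  show "eventually (\<lambda>t. - ln (task_tail t) / tail_rate t \<le> - ln (delay_tail t) / tail_rate t) at_top"
    using task_tail_bounds eventually_delay_tail_pos eventually_tail_rate_pos
  proof eventually_elim
    case (elim t)
    have "ln (delay_tail t) \<le> ln (task_tail t)" using elim by (intro ln_mono) auto
    then show ?case using elim by (intro divide_right_mono) auto
  qed
qed

lemma log_equiv_task_delay: "log_equiv task_tail delay_tail"
  unfolding log_equiv_def
proof (rule Lim_transform_eventually)
  show "((\<lambda>t. (- ln (task_tail t) / tail_rate t) / (- ln (delay_tail t) / tail_rate t)) \<longlongrightarrow> 1) at_top"
    using tendsto_divide[OF task_tail_log_asymptotics delay_tail_log_asymptotics] by simp
  show "eventually (\<lambda>t. (- ln (task_tail t) / tail_rate t) / (- ln (delay_tail t) / tail_rate t)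
      = ln (task_tail t) / ln (delay_tail t)) at_top"
    using eventually_tail_rate_pos by eventually_elim simp
qed

lemma log_equiv_delay_exp:
  "log_equiv delay_tail (\<lambda>t. exp (- (a * b / (b + 1)) * t powr (b + 1) * ln t / l))"
  using delay_tail_log_asymptotics unfolding log_equiv_def tail_rate_def by simp

end

section \<open>The delay and the total task time\<close>

theorem corollary6p1:
  fixes M :: "'a measure" and r :: "real \<Rightarrow> real" and l \<mu> :: real
    and T :: "nat \<Rightarrow> 'a \<Rightarrow> real"
  assumes "prob_space M"
    and "l > 0"
    and "continuous_on {0..} r"
    and "\<And>t. t > 0 \<Longrightarrow> r t > 0"
    and "filterlim (cumulative_work r) at_top at_top"
    and "\<mu> > 0"
    and "poisson_epochs M \<mu> T"
  shows "(Limsup at_top (\<lambda>t. ereal (\<mu> / (r t * ln (cumulative_work r t)))) < ereal (1 / l)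
            \<longrightarrow> (AE \<omega> in M. task_time r l T \<omega> < \<infinity>))
       \<and> (Liminf at_top (\<lambda>t. ereal (\<mu> / (r t * ln (cumulative_work r t)))) > ereal (1 / l)
            \<longrightarrow> measure M {\<omega> \<in> space M. task_time r l T \<omega> = \<infinity>} > 0)
       \<and> (\<forall>a b. a > 0 \<and> b > 0 \<and> (\<forall>t\<ge>0. r t = a * t powr b) \<longrightarrow>
            log_equiv (\<lambda>t. measure M {\<omega> \<in> space M. task_time r l T \<omega> > ereal t})
                      (\<lambda>t. measure M {\<omega> \<in> space M. delay r l T \<omega> > ereal t})
          \<and> log_equiv (\<lambda>t. measure M {\<omega> \<in> space M. delay r l T \<omega> > ereal t})
                      (\<lambda>t. exp (- (a * b / (b + 1)) * t powr (b + 1) * ln t / l)))"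
proof -
  interpret restarted_task r M T \<mu> l
    using assms by (simp add: restarted_task_def restarted_task_axioms_def work_rate_def
        poisson_failures_def poisson_failures_axioms_def)
  show ?thesis
  proof (intro conjI impI allI)
    assume "Limsup at_top (\<lambda>t. ereal (\<mu> / (r t * ln (R t)))) < ereal (1 / l)"
    then obtain c where c: "Limsup at_top (\<lambda>t. ereal (\<mu> / (r t * ln (R t)))) < ereal c" "ereal c < ereal (1 / l)"
      using ereal_dense2 by blast
    \<comment> \<open>The bound \<open>c\<close> may be nonpositive, so it is raised to a positive number still below \<open>1 / l\<close>.\<close>
    define c' where "c' = max c (1 / (2 * l))"
    have "eventually (\<lambda>t. \<mu> / (r t * ln (R t)) < c') at_top"
      using Limsup_lessD[OF c(1)] by eventually_elim (simp add: c'_def)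
    moreover have "0 < c'" "c' < 1 / l"
      using c(2) work_pos by (auto simp: c'_def less_max_iff_disj field_simps)
    ultimately have "AE \<omega> in M. D \<omega> < \<infinity>" by (intro delay_finite_if_slow_failures)
    then show "AE \<omega> in M. X \<omega> < \<infinity>"
      by (simp only: task_time_less_infinity_iff)
  next
    assume "ereal (1 / l) < Liminf at_top (\<lambda>t. ereal (\<mu> / (r t * ln (R t))))"
    then obtain c where c: "ereal (1 / l) < ereal c" "ereal c < Liminf at_top (\<lambda>t. ereal (\<mu> / (r t * ln (R t))))"
      using ereal_dense2 by blast
    have "eventually (\<lambda>t. c < \<mu> / (r t * ln (R t))) at_top"
      using less_LiminfD[OF c(2)] by eventually_elim simp
    then have "0 < prob {\<omega> \<in> space M. D \<omega> = \<infinity>}"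
      using c(1) by (intro delay_infinite_if_fast_failures) auto
    moreover have "X \<omega> = \<infinity> \<longleftrightarrow> D \<omega> = \<infinity>" for \<omega> using task_time_less_infinity_iff[of \<omega>] by simp
    ultimately show "0 < prob {\<omega> \<in> space M. X \<omega> = \<infinity>}" by simp
  next
    fix a b assume ab: "0 < a \<and> 0 < b \<and> (\<forall>t\<ge>0. r t = a * t powr b)"
    interpret power_rate_task r M T \<mu> l a b
      using ab by unfold_locales auto
    show "log_equiv task_tail delay_tail" by (rule log_equiv_task_delay)
    show "log_equiv delay_tail (\<lambda>t. exp (- (a * b / (b + 1)) * t powr (b + 1) * ln t / l))"
      by (rule log_equiv_delay_exp)
  qed
qed

end
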